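(* Let $d\ge2$ and let $\Gamma<\mathsf{PGL}_d(\mathbb R)$ be a projective Anosov subgroup with limit set $L_\Gamma\subset\mathbb P(\mathbb R^d)$. Then $$\dim_{\mathrm{Hff}}(L_\Gamma)\le h^{\mathrm{Aff}}_\Gamma ,$$ where $\dim_{\mathrm{Hff}}$ denotes Hausdorff dimension and $h^{\mathrm{Aff}}_\Gamma$ is the affinity exponent of $\Gamma$.
   Context: Fix a scalar product on $\mathbb R^d$ and let $\sigma_1(g)\ge\dots\ge\sigma_d(g)$ be the singular values of (a representative of) $g\in\mathsf{PGL}_d(\mathbb R)$; only ratios $\frac{\sigma_i}{\sigma_j}(g)=\sigma_i(g)/\sigma_j(g)$ are used. Projective Anosov: a finitely generated subgroup $\Gamma$ with word length $|\cdot|$ is projective Anosov if there are $c,\mu>0$ with $\frac{\sigma_2}{\sigma_1}(\gamma)\le ce^{-\mu|\gamma|}$ for all $\gamma\in\Gamma$. Then $\Gamma$ is word-hyperbolic, and there is a continuous equivariant injective map $\xi^1:\partial\Gamma\to\mathbb P(\mathbb R^d)$, $\xi^1(x)=\lim_i U_1(\alpha_i)$ for any geodesic ray $(\alpha_i)$ from the identity to $x$, where $U_1(g)$ is the line spanned by the major axis of the ellipsoid $\{gv:\|v\|=1\}$. The limit set is $L_\Gamma=\xi^1(\partial\Gamma)$. Hausdorff dimension is with respect to the distance $d([v],[w])=\sin\angle(v,w)$ on $\mathbb P(\mathbb R^d)$. Affinity exponent: for $p\in\{1,\dots,d-1\}$ and $s\in[p-1,p]$ put $$\Phi^{\mathrm{Aff}}_\Gamma(s)=\sum_{\gamma\in\Gamma}\Big(\frac{\sigma_2}{\sigma_1}(\gamma)\cdots\frac{\sigma_p}{\sigma_1}(\gamma)\Big)\Big(\frac{\sigma_{p+1}}{\sigma_1}(\gamma)\Big)^{s-(p-1)},$$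 and $h^{\mathrm{Aff}}_\Gamma=\inf\{s:\Phi^{\mathrm{Aff}}_\Gamma(s)<\infty\}$, with the convention $\inf\emptyset=+\infty$. *)

theory Defs
  imports "HOL-Analysis.Analysis" "HOL-Algebra.Generated_Groups"
begin

text \<open>The space \<open>\<real>\<^sup>d\<close> with its fixed scalar product is a type \<^typ>\<open>'a\<close> of class
  \<^class>\<open>euclidean_space\<close>, with \<open>d = DIM('a)\<close>.\<close>

section \<open>The projective linear group\<close>

definition GL :: "('a::euclidean_space \<Rightarrow> 'a) monoid" where
  "GL = \<lparr>carrier = {f. linear f \<and> bij f}, mult = (\<circ>), one = id\<rparr>"

definition homotheties :: "('a::euclidean_space \<Rightarrow> 'a) set" where
  "homotheties = {(*\<^sub>R) c | c. c \<noteq> 0}"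

text \<open>Elements of \<open>PGL\<close> are cosets, i.e. sets of linear automorphisms which are nonzero multiples
  of each other.\<close>

definition PGL :: "('a::euclidean_space \<Rightarrow> 'a) set monoid" where
  "PGL = GL Mod homotheties"

definition representative :: "('a \<Rightarrow> 'a) set \<Rightarrow> 'a \<Rightarrow> 'a" where
  "representative g = (SOME f. f \<in> g)"

lemma linear_inv_of_bij:
  fixes f :: "'a::euclidean_space \<Rightarrow> 'a"
  assumes "linear f" "bij f"
  shows "linear (inv_into UNIV f)"
  by (metis assms bij_is_inj bij_is_surj inv_o_cancel linear_injective_left_inverse
      left_right_inverse_eq surj_iff)

lemma group_GL: "group (GL :: ('a::euclidean_space \<Rightarrow> 'a) monoid)"
proof (rule groupI)
  fix f :: "'a \<Rightarrow> 'a"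
  assume "f \<in> carrier GL"
  then show "\<exists>g\<in>carrier GL. g \<otimes>\<^bsub>GL\<^esub> f = \<one>\<^bsub>GL\<^esub>"
    by (intro bexI[of _ "inv_into UNIV f"])
      (auto simp: GL_def linear_inv_of_bij bij_imp_bij_inv bij_is_inj)
qed (auto simp: GL_def bij_comp o_assoc linear_iff)

lemma homotheties_subgroup: "subgroup homotheties (GL :: ('a::euclidean_space \<Rightarrow> 'a) monoid)"
proof -
  interpret group "GL :: ('a \<Rightarrow> 'a) monoid" by (rule group_GL)
  have carr: "(*\<^sub>R) c \<in> carrier (GL :: ('a \<Rightarrow> 'a) monoid)" if "c \<noteq> 0" for c
  proof -
    have "bij ((*\<^sub>R) c :: 'a \<Rightarrow> 'a)"
      using that by (intro o_bij[of "(*\<^sub>R) (inverse c)"]) auto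
    then show ?thesis
      by (simp add: GL_def linear_scale_self)
  qed
  have invr: "inv\<^bsub>GL\<^esub> ((*\<^sub>R) c :: 'a \<Rightarrow> 'a) = (*\<^sub>R) (inverse c)" if "c \<noteq> 0" for c
    using that carr[of c] carr[of "inverse c"] by (intro inv_equality) (auto simp: GL_def)
  show ?thesis
  proof (rule subgroupI)
    show "homotheties \<subseteq> carrier (GL :: ('a \<Rightarrow> 'a) monoid)"
      using carr by (auto simp: homotheties_def)
    show "(homotheties :: ('a \<Rightarrow> 'a) set) \<noteq> {}"
      by (auto simp: homotheties_def intro: exI[of _ 1])
    show "inv\<^bsub>GL\<^esub> f \<in> homotheties" if "f \<in> homotheties" for f :: "'a \<Rightarrow> 'a"
      using that invr unfolding homotheties_def by fastforce
    show "f \<otimes>\<^bsub>GL\<^esub> g \<in> homotheties" if "f \<in> homotheties" "g \<in> homotheties" for f g :: "'a \<Rightarrow> 'a"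
    proof -
      from that obtain a b where "f = (*\<^sub>R) a" "g = (*\<^sub>R) b" "a \<noteq> 0" "b \<noteq> 0"
        by (auto simp: homotheties_def)
      then have "f \<otimes>\<^bsub>GL\<^esub> g = (*\<^sub>R) (a * b)" "a * b \<noteq> 0"
        by (auto simp: GL_def)
      then show ?thesis by (auto simp: homotheties_def)
    qed
  qed
qed

lemma homotheties_normal: "homotheties \<lhd> (GL :: ('a::euclidean_space \<Rightarrow> 'a) monoid)"
proof -
  interpret group "GL :: ('a \<Rightarrow> 'a) monoid" by (rule group_GL)
  show ?thesis
  proof (rule normal_invI[OF homotheties_subgroup])
    fix f h :: "'a \<Rightarrow> 'a"
    assume f: "f \<in> carrier GL" and h: "h \<in> homotheties"
    then obtain c where c: "h = (*\<^sub>R) c"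
      by (auto simp: homotheties_def)
    have lin: "linear f" using f by (simp add: GL_def)
    have "f \<otimes>\<^bsub>GL\<^esub> h = h \<otimes>\<^bsub>GL\<^esub> f"
      by (auto simp: GL_def c fun_eq_iff linear_scale[OF lin])
    moreover have "h \<in> carrier GL"
      using h homotheties_subgroup subgroup.subset by blast
    ultimately have "f \<otimes>\<^bsub>GL\<^esub> h \<otimes>\<^bsub>GL\<^esub> inv\<^bsub>GL\<^esub> f = h"
      using f by (simp add: m_assoc)
    then show "f \<otimes>\<^bsub>GL\<^esub> h \<otimes>\<^bsub>GL\<^esub> inv\<^bsub>GL\<^esub> f \<in> homotheties"
      using h by simp
  qed
qed

lemma group_PGL: "group (PGL :: ('a::euclidean_space \<Rightarrow> 'a) set monoid)"
  unfolding PGL_def by (rule normal.factorgroup_is_group[OF homotheties_normal])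


section \<open>Singular values\<close>

definition eigenspace :: "('a::real_vector \<Rightarrow> 'a) \<Rightarrow> real \<Rightarrow> 'a set" where
  "eigenspace T l = {v. T v = l *\<^sub>R v}"

text \<open>The square roots of the eigenvalues of \<open>f\<^sup>* f\<close>, with multiplicity.\<close>

definition singular_values :: "('a::euclidean_space \<Rightarrow> 'a) \<Rightarrow> real multiset" where
  "singular_values f = (\<Sum>l | eigenspace (adjoint f \<circ> f) l \<noteq> {0}.
     replicate_mset (dim (eigenspace (adjoint f \<circ> f) l)) (sqrt l))"

text \<open>Indices run from \<open>1\<close> to \<open>DIM('a)\<close>, in decreasing order of the singular values.\<close>

definition singular_value :: "nat \<Rightarrow> ('a::euclidean_space \<Rightarrow> 'a) \<Rightarrow> real" where
  "singular_value i f = rev (sorted_list_of_multiset (singular_values f)) ! (i - 1)"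

definition sv_ratio :: "nat \<Rightarrow> nat \<Rightarrow> ('a::euclidean_space \<Rightarrow> 'a) set \<Rightarrow> real" where
  "sv_ratio i j g = singular_value i (representative g) / singular_value j (representative g)"


section \<open>Projective space\<close>

typedef (overloaded) 'a proj = "{span {v} | v :: 'a::euclidean_space. v \<noteq> 0}"
  using nonzero_Basis SOME_Basis by blast

definition proj_line :: "'a::euclidean_space \<Rightarrow> 'a proj" where
  "proj_line v = Abs_proj (span {v})"

definition proj_vec :: "'a::euclidean_space proj \<Rightarrow> 'a" where
  "proj_vec L = (SOME v. v \<in> Rep_proj L \<and> v \<noteq> 0)"

definition vec_angle :: "'a::real_inner \<Rightarrow> 'a \<Rightarrow> real" where
  "vec_angle v w = arccos (v \<bullet> w / (norm v * norm w))"

lemma span_scaled_singleton: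
  fixes v :: "'a::real_vector"
  assumes "k \<noteq> 0"
  shows "span {k *\<^sub>R v} = span {v}"
proof
  show "span {k *\<^sub>R v} \<subseteq> span {v}"
    by (intro span_minimal) (auto intro: span_scale span_base)
  have "inverse k *\<^sub>R (k *\<^sub>R v) \<in> span {k *\<^sub>R v}"
    by (intro span_scale span_base) simp
  then show "span {v} \<subseteq> span {k *\<^sub>R v}"
    using assms by (intro span_minimal) auto
qed

lemma Rep_proj_line: "v \<noteq> 0 \<Longrightarrow> Rep_proj (proj_line v) = span {v}"
  unfolding proj_line_def by (rule Abs_proj_inverse) blast

lemma proj_vec: "proj_vec L \<noteq> 0" "proj_line (proj_vec L) = L"
proof -
  obtain v where v: "v \<noteq> 0" "Rep_proj L = span {v}"
    using Rep_proj[of L] by blast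
  have "proj_vec L \<in> Rep_proj L \<and> proj_vec L \<noteq> 0"
    unfolding proj_vec_def
    by (rule someI[of _ v]) (use v in \<open>auto intro: span_base\<close>)
  then show nz: "proj_vec L \<noteq> 0" and "proj_line (proj_vec L) = L"
  proof -
    assume a: "proj_vec L \<in> Rep_proj L \<and> proj_vec L \<noteq> 0"
    then obtain k where k: "proj_vec L = k *\<^sub>R v"
      using v by (auto simp: span_singleton)
    with a have "k \<noteq> 0" by auto
    then have "span {proj_vec L} = span {v}"
      unfolding k by (rule span_scaled_singleton)
    then show "proj_line (proj_vec L) = L"
      using v by (metis Rep_proj_inverse proj_line_def)
  qed simp
qed

lemma proj_line_eq_iff:
  assumes "v \<noteq> 0" "w \<noteq> 0"
  shows "proj_line v = proj_line w \<longleftrightarrow> (\<exists>k. w = k *\<^sub>R v)"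
proof
  assume "proj_line v = proj_line w"
  then have "span {v} = span {w}"
    using assms by (metis Rep_proj_line)
  then have "w \<in> span {v}" by (simp add: span_base)
  then show "\<exists>k. w = k *\<^sub>R v" by (auto simp: span_singleton)
next
  assume "\<exists>k. w = k *\<^sub>R v"
  then obtain k where k: "w = k *\<^sub>R v" by blast
  with assms have "k \<noteq> 0" by auto
  then have "span {w} = span {v}"
    unfolding k by (rule span_scaled_singleton)
  then show "proj_line v = proj_line w" by (simp add: proj_line_def)
qed

lemma sin_vec_angle:
  fixes v w :: "'a::real_inner"
  shows "sin (vec_angle v w) = sqrt (1 - (v \<bullet> w / (norm v * norm w))\<^sup>2)"
proof -
  have "\<bar>v \<bullet> w / (norm v * norm w)\<bar> \<le> 1"
    using Cauchy_Schwarz_ineq2[of v w] by (auto simp: divide_le_eq_1 abs_mult)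
  then show ?thesis
    unfolding vec_angle_def abs_le_iff by (intro sin_arccos) linarith+
qed

lemma sin_vec_angle_scale:
  fixes v w :: "'a::real_inner"
  assumes "a \<noteq> 0" "b \<noteq> 0"
  shows "sin (vec_angle (a *\<^sub>R v) (b *\<^sub>R w)) = sin (vec_angle v w)"
  using assms by (simp add: sin_vec_angle power_mult_distrib power_divide)

lemma sin_vec_angle_le:
  fixes v w :: "'a::real_inner"
  assumes "norm v = 1" "norm w = 1"
  shows "sin (vec_angle v w) \<le> norm (w - t *\<^sub>R v)"
    and "sin (vec_angle v w) = norm (w - (v \<bullet> w) *\<^sub>R v)"
proof -
  have vv: "v \<bullet> v = 1" "w \<bullet> w = 1"
    using assms by (simp_all add: dot_square_norm)
  have n: "norm (w - s *\<^sub>R v) = sqrt (1 - 2 * s * (v \<bullet> w) + s\<^sup>2)" for s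
    by (simp add: norm_eq_sqrt_inner inner_diff_left inner_diff_right vv inner_commute
        power2_eq_square algebra_simps)
  have "0 \<le> (t - v \<bullet> w)\<^sup>2" by simp
  then have "1 - (v \<bullet> w)\<^sup>2 \<le> 1 - 2 * t * (v \<bullet> w) + t\<^sup>2"
    by (simp add: power2_diff)
  then show "sin (vec_angle v w) \<le> norm (w - t *\<^sub>R v)"
    by (simp add: n sin_vec_angle assms)
  show "sin (vec_angle v w) = norm (w - (v \<bullet> w) *\<^sub>R v)"
    by (simp add: n sin_vec_angle assms power2_eq_square)
qed

instantiation proj :: (euclidean_space) metric_space
begin

definition dist_proj :: "'a proj \<Rightarrow> 'a proj \<Rightarrow> real" where
  "dist_proj L M = sin (vec_angle (proj_vec L) (proj_vec M))"

definition uniformity_proj :: "('a proj \<times> 'a proj) filter" where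
  "uniformity_proj = (INF e\<in>{0<..}. principal {(x, y). dist x y < e})"

definition open_proj :: "'a proj set \<Rightarrow> bool" where
  "open_proj U = (\<forall>x\<in>U. eventually (\<lambda>(x', y). x' = x \<longrightarrow> y \<in> U) uniformity)"

instance
proof
  fix L M N :: "'a proj"
  have unit: "\<exists>v. norm v = 1 \<and> (\<exists>a. a \<noteq> 0 \<and> proj_vec L = a *\<^sub>R v)" for L :: "'a proj"
    by (intro exI[of _ "sgn (proj_vec L)"] conjI exI[of _ "norm (proj_vec L)"])
      (auto simp: norm_sgn sgn_div_norm proj_vec)
  obtain u a where u: "norm u = 1" "a \<noteq> 0" "proj_vec L = a *\<^sub>R u" using unit by blast
  obtain v b where v: "norm v = 1" "b \<noteq> 0" "proj_vec M = b *\<^sub>R v" using unit by blast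
  obtain w c where w: "norm w = 1" "c \<noteq> 0" "proj_vec N = c *\<^sub>R w" using unit by blast
  note d = dist_proj_def sin_vec_angle_scale u(2,3) v(2,3) w(2,3)
  show "dist L M = 0 \<longleftrightarrow> L = M"
  proof -
    have "dist L M = norm (v - (u \<bullet> v) *\<^sub>R u)"
      by (simp add: d sin_vec_angle_le(2)[OF u(1) v(1)])
    then have "dist L M = 0 \<longleftrightarrow> v = (u \<bullet> v) *\<^sub>R u" by simp
    also have "\<dots> \<longleftrightarrow> (\<exists>k. v = k *\<^sub>R u)"
    proof
      assume "\<exists>k. v = k *\<^sub>R u"
      then obtain k where k: "v = k *\<^sub>R u" by blast
      have "u \<bullet> v = k" using u(1) by (simp add: k dot_square_norm)
      with k show "v = (u \<bullet> v) *\<^sub>R u" by simp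
    qed blast
    also have "\<dots> \<longleftrightarrow> (\<exists>k. proj_vec M = k *\<^sub>R proj_vec L)"
    proof
      assume "\<exists>k. v = k *\<^sub>R u"
      then obtain k where "v = k *\<^sub>R u" by blast
      then show "\<exists>k. proj_vec M = k *\<^sub>R proj_vec L"
        using u v by (intro exI[of _ "b * k / a"]) simp
    next
      assume "\<exists>k. proj_vec M = k *\<^sub>R proj_vec L"
      then obtain k where "b *\<^sub>R v = k *\<^sub>R a *\<^sub>R u" using u v by auto
      then have "(1 / b) *\<^sub>R b *\<^sub>R v = (1 / b) *\<^sub>R k *\<^sub>R a *\<^sub>R u" by simp
      then have "v = (k * a / b) *\<^sub>R u"
        using v(2) by (simp add: mult.commute)
      then show "\<exists>k. v = k *\<^sub>R u" by blast
    qed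
    also have "\<dots> \<longleftrightarrow> L = M"
      using proj_line_eq_iff[of "proj_vec L" "proj_vec M"] by (simp add: proj_vec)
    finally show ?thesis .
  qed
  have "sin (vec_angle v u) \<le> norm (u - ((w \<bullet> u) * (v \<bullet> w)) *\<^sub>R v)"
    by (rule sin_vec_angle_le(1)[OF v(1) u(1)])
  also have "u - ((w \<bullet> u) * (v \<bullet> w)) *\<^sub>R v
      = (u - (w \<bullet> u) *\<^sub>R w) + (w \<bullet> u) *\<^sub>R (w - (v \<bullet> w) *\<^sub>R v)"
    by (simp add: scaleR_diff_right)
  also have "norm \<dots> \<le> norm (u - (w \<bullet> u) *\<^sub>R w) + \<bar>w \<bullet> u\<bar> * norm (w - (v \<bullet> w) *\<^sub>R v)"
    by (metis norm_scaleR norm_triangle_ineq)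
  also have "\<dots> \<le> norm (u - (w \<bullet> u) *\<^sub>R w) + 1 * norm (w - (v \<bullet> w) *\<^sub>R v)"
    using Cauchy_Schwarz_ineq2[of w u] u(1) w(1) by (intro add_left_mono mult_right_mono) auto
  finally have tri: "sin (vec_angle v u) \<le> sin (vec_angle w u) + sin (vec_angle v w)"
    by (simp add: sin_vec_angle_le(2) u v w)
  have sym: "sin (vec_angle x y) = sin (vec_angle y x)" for x y :: 'a
    by (simp add: vec_angle_def inner_commute mult.commute)
  have "sin (vec_angle u v) \<le> sin (vec_angle u w) + sin (vec_angle v w)"
    using tri unfolding sym[of u v] sym[of u w] .
  then show "dist L M \<le> dist L N + dist M N"
    by (simp add: d)
qed (simp_all add: uniformity_proj_def open_proj_def)

end

lemma dist_proj_line: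
  assumes "v \<noteq> 0" "w \<noteq> 0"
  shows "dist (proj_line v) (proj_line w) = sin (vec_angle v w)"
proof -
  have *: "\<exists>a. a \<noteq> 0 \<and> proj_vec (proj_line v) = a *\<^sub>R v" if nz: "v \<noteq> 0" for v :: 'a
  proof -
    have "proj_line v = proj_line (proj_vec (proj_line v))"
      by (simp add: proj_vec)
    then obtain a where "proj_vec (proj_line v) = a *\<^sub>R v"
      using proj_line_eq_iff[OF nz proj_vec(1)[of "proj_line v"]] by blast
    moreover from this have "a \<noteq> 0"
      using proj_vec(1)[of "proj_line v"] by auto
    ultimately show ?thesis by blast
  qed
  from *[OF assms(1)] *[OF assms(2)] show ?thesis
    by (auto simp: dist_proj_def sin_vec_angle_scale)
qed

text \<open>The line spanned by a point of the ellipsoid \<open>{g v. norm v = 1}\<close> farthest from the origin. It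
  is uniquely determined when \<open>sv_ratio 2 1 g < 1\<close>.\<close>

definition major_axis :: "('a::euclidean_space \<Rightarrow> 'a) set \<Rightarrow> 'a proj" where
  "major_axis g = (let E = representative g ` sphere 0 1
     in proj_line (SOME w. w \<in> E \<and> (\<forall>u\<in>E. norm u \<le> norm w)))"


section \<open>Word metric and boundary of a finitely generated group\<close>

definition word_length :: "('g, 'm) monoid_scheme \<Rightarrow> 'g set \<Rightarrow> 'g \<Rightarrow> nat" where
  "word_length G S g = (LEAST n. \<exists>ws. length ws = n \<and> set ws \<subseteq> S \<union> m_inv G ` S \<and>
     foldr (mult G) ws \<one>\<^bsub>G\<^esub> = g)"

definition word_dist :: "('g, 'm) monoid_scheme \<Rightarrow> 'g set \<Rightarrow> 'g \<Rightarrow> 'g \<Rightarrow> nat" where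
  "word_dist G S g h = word_length G S (inv\<^bsub>G\<^esub> g \<otimes>\<^bsub>G\<^esub> h)"

definition geodesic_rays :: "('g, 'm) monoid_scheme \<Rightarrow> 'g set \<Rightarrow> (nat \<Rightarrow> 'g) set" where
  "geodesic_rays G S = {\<alpha>. \<alpha> 0 = \<one>\<^bsub>G\<^esub> \<and> range \<alpha> \<subseteq> carrier G \<and>
     (\<forall>i j. i \<le> j \<longrightarrow> word_dist G S (\<alpha> i) (\<alpha> j) = j - i)}"

definition asymptotic_rays ::
    "('g, 'm) monoid_scheme \<Rightarrow> 'g set \<Rightarrow> ((nat \<Rightarrow> 'g) \<times> (nat \<Rightarrow> 'g)) set" where
  "asymptotic_rays G S = {(\<alpha>, \<beta>). \<alpha> \<in> geodesic_rays G S \<and> \<beta> \<in> geodesic_rays G S \<and>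
     (\<exists>K. \<forall>i. word_dist G S (\<alpha> i) (\<beta> i) \<le> K)}"

text \<open>For a hyperbolic group with finite generating set \<open>S\<close> this is the Gromov boundary: geodesic
  rays of the Cayley graph issuing from the identity, up to bounded distance.\<close>

definition group_boundary :: "('g, 'm) monoid_scheme \<Rightarrow> 'g set \<Rightarrow> (nat \<Rightarrow> 'g) set set" where
  "group_boundary G S = geodesic_rays G S // asymptotic_rays G S"


section \<open>Projective Anosov subgroups and their limit sets\<close>

abbreviation subgroup_of_PGL ::
    "('a::euclidean_space \<Rightarrow> 'a) set set \<Rightarrow> ('a \<Rightarrow> 'a) set monoid" where
  "subgroup_of_PGL \<Gamma> \<equiv> PGL\<lparr>carrier := \<Gamma>\<rparr>"

text \<open>The finite generating set \<open>S\<close> which defines the word length is kept as a parameter.\<close>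

definition projective_anosov ::
    "('a::euclidean_space \<Rightarrow> 'a) set set \<Rightarrow> ('a \<Rightarrow> 'a) set set \<Rightarrow> bool" where
  "projective_anosov \<Gamma> S \<longleftrightarrow>
     subgroup \<Gamma> PGL \<and> finite S \<and> S \<subseteq> \<Gamma> \<and> generate (subgroup_of_PGL \<Gamma>) S = \<Gamma> \<and>
     (\<exists>c>0. \<exists>\<mu>>0. \<forall>\<gamma>\<in>\<Gamma>.
        sv_ratio 2 1 \<gamma> \<le> c * exp (- \<mu> * real (word_length (subgroup_of_PGL \<Gamma>) S \<gamma>)))"

definition boundary_map :: "(nat \<Rightarrow> ('a::euclidean_space \<Rightarrow> 'a) set) set \<Rightarrow> 'a proj" where
  "boundary_map x = (THE L. \<forall>\<alpha>\<in>x. (\<lambda>i. major_axis (\<alpha> i)) \<longlonglongrightarrow> L)"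

definition limit_set ::
    "('a::euclidean_space \<Rightarrow> 'a) set set \<Rightarrow> ('a \<Rightarrow> 'a) set set \<Rightarrow> 'a proj set" where
  "limit_set \<Gamma> S = boundary_map ` group_boundary (subgroup_of_PGL \<Gamma>) S"


section \<open>Hausdorff dimension\<close>

definition hausdorff_premeasure :: "real \<Rightarrow> real \<Rightarrow> 'b::metric_space set \<Rightarrow> ennreal" where
  "hausdorff_premeasure s \<delta> A =
     (INF U \<in> {U :: nat \<Rightarrow> 'b set. A \<subseteq> (\<Union>n. U n) \<and> (\<forall>n. bounded (U n) \<and> diameter (U n) \<le> \<delta>)}.
        \<Sum>n. ennreal (diameter (U n) powr s))"

definition hausdorff_measure :: "real \<Rightarrow> 'b::metric_space set \<Rightarrow> ennreal" where
  "hausdorff_measure s A = (SUP \<delta>\<in>{0<..}. hausdorff_premeasure s \<delta> A)"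

text \<open>Leaving out \<open>s = 0\<close> does not affect the infimum and avoids a convention for \<open>0\<^sup>0\<close>.\<close>

definition hausdorff_dim :: "'b::metric_space set \<Rightarrow> ereal" where
  "hausdorff_dim A = Inf {ereal s | s. s > 0 \<and> hausdorff_measure s A = 0}"


section \<open>Affinity exponent\<close>

text \<open>Meant for \<open>s \<in> [p - 1, p]\<close>: this determines \<open>p\<close> unless \<open>s\<close> is integral, in which case the
  admissible values of \<open>p\<close> give the same series.\<close>

definition affinity_series :: "('a::euclidean_space \<Rightarrow> 'a) set set \<Rightarrow> nat \<Rightarrow> real \<Rightarrow> ennreal" where
  "affinity_series \<Gamma> p s = (\<Sum>\<^sub>\<infinity>\<gamma>\<in>\<Gamma>. ennreal
     ((\<Prod>i=2..p. sv_ratio i 1 \<gamma>) * sv_ratio (p + 1) 1 \<gamma> powr (s - (real p - 1))))"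

definition affinity_exponent :: "('a::euclidean_space \<Rightarrow> 'a) set set \<Rightarrow> ereal" where
  "affinity_exponent \<Gamma> = Inf {ereal s | s p. p \<in> {1..DIM('a) - 1} \<and> real p - 1 \<le> s \<and> s \<le> real p \<and>
     affinity_series \<Gamma> p s < \<infinity>}"

end

theory Submission
  imports Defs
begin

text \<open>
  A limit point is the limit of the major axes of \<open>\<alpha>\<^sub>k\<close> along a geodesic ray \<open>\<alpha>\<close>. The upper bound for
  the dimension comes from efficient coverings: for each \<open>n\<close>, this limit point lies in a set attached
  to the single group element \<open>\<gamma> = \<alpha>\<^sub>n\<close>, namely in the projective image of an ellipsoid with semi-axes
  comparable to \<open>\<sigma>\<^sub>2 / \<sigma>\<^sub>1, \<dots>, \<sigma>\<^sub>d / \<sigma>\<^sub>1\<close> of \<open>\<gamma>\<close> (\<open>limit_set_in_shadows\<close>). Such an ellipsoid is covered by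
  about \<open>(\<sigma>\<^sub>2 \<cdots> \<sigma>\<^sub>p) / \<sigma>\<^sub>p\<^sub>+\<^sub>1 ^ (p - 1)\<close> cubes of side \<open>\<sigma>\<^sub>p\<^sub>+\<^sub>1 / \<sigma>\<^sub>1\<close> (\<open>ellipsoid_cover\<close>), and the sum of the
  \<open>s\<close>-th powers of their diameters is, up to a constant, the term of \<open>\<gamma>\<close> in the affinity series. If
  the series converges at \<open>s\<close>, its part over the elements of length \<open>n\<close> tends to \<open>0\<close>, so
  the limit set has Hausdorff measure zero in every dimension above \<open>s\<close>
  (\<open>hausdorff_measure_limit_set_zero\<close>).

  That the limit point lies in the ellipsoid is a transversality statement: it says that \<open>\<gamma>\<^sup>-\<^sup>1 \<alpha>\<^sub>k\<close>, for
  \<open>k \<ge> n\<close>, does not have its major axis close to the hyperplane of directions that \<open>\<gamma>\<close> contracts. It is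
  expressed by norms alone: there is \<open>\<epsilon> > 0\<close> with \<open>onorm (\<gamma> \<delta>) \<ge> \<epsilon> onorm \<gamma> onorm \<delta>\<close> whenever \<open>\<gamma>\<close> and \<open>\<delta>\<close> are
  consecutive pieces of a geodesic (\<open>coarse_multiplicativity\<close>). The proof is a bisection argument
  based on one inequality for products of three matrices, \<open>onorm_three_factors\<close>: the defect of
  multiplicativity at a point of the geodesic is determined by the nearby letters up to an exponentially small error. A very large defect
  would therefore persist at all scales in a long window around the point and would make the product
  over this window, compared with the norms of its letters, smaller than their bounded condition
  numbers permit.

  Singular values are defined by the eigenvalues of \<open>f\<^sup>* f\<close>; the spectral theorem turns them into
  semi-axes of ellipsoids (\<open>singular_value_decomposition\<close>).
\<close>

section \<open>Symmetric operators and the singular value decomposition\<close>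

text \<open>A maximiser \<open>x\<close> of the Rayleigh quotient on the unit sphere of \<open>V\<close> is an eigenvector: with \<open>m\<close>
  the maximum, the form \<open>m (y \<bullet> y) - T y \<bullet> y\<close> is nonnegative on \<open>V\<close> and vanishes at \<open>x\<close>, so its
  derivative at \<open>x\<close> in the direction \<open>m x - T x\<close>, which is twice the squared norm of that
  vector, is zero.\<close>

lemma symmetric_eigenvector_exists:
  fixes T :: "'a::euclidean_space \<Rightarrow> 'a"
  assumes lin: "linear T" and sym: "\<And>x y. T x \<bullet> y = x \<bullet> T y"
    and V: "subspace V" "T ` V \<subseteq> V" "V \<noteq> {0}"
  obtains x l where "x \<in> V" "norm x = 1" "T x = l *\<^sub>R x"
proof -
  define C where "C = V \<inter> sphere 0 1"
  obtain w where w: "w \<in> V" "w \<noteq> 0"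
    using V subspace_0 by auto
  then have "sgn w \<in> C"
    using V(1) by (auto simp: C_def sgn_div_norm subspace_scale)
  moreover have "compact C"
    unfolding C_def using closed_subspace[OF V(1)] compact_sphere by (auto simp: Int_commute intro: compact_Int_closed)
  moreover have "continuous_on C (\<lambda>x. T x \<bullet> x)"
    using lin by (intro continuous_intros linear_continuous_on linear_conv_bounded_linear[THEN iffD1])
  ultimately obtain x where x: "x \<in> C" "\<And>y. y \<in> C \<Longrightarrow> T y \<bullet> y \<le> T x \<bullet> x"
    using continuous_attains_sup[of C "\<lambda>x. T x \<bullet> x"] by blast
  define m where "m = T x \<bullet> x"
  define Q where "Q y = m * (y \<bullet> y) - T y \<bullet> y" for y
  have xV: "x \<in> V" "norm x = 1" "x \<bullet> x = 1"
    using x by (auto simp: C_def dot_square_norm)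
  have Q: "Q y \<ge> 0" if "y \<in> V" for y
  proof (cases "y = 0")
    case False
    then have "sgn y \<in> C"
      using that V(1) by (auto simp: C_def sgn_div_norm subspace_scale)
    then have "T (sgn y) \<bullet> sgn y \<le> m" using x by (simp add: m_def)
    then have "(T y \<bullet> y) / (norm y)^2 \<le> m"
      by (simp add: sgn_div_norm linear_scale[OF lin] power2_eq_square field_simps)
    then show ?thesis
      using False by (simp add: Q_def dot_square_norm field_simps)
  qed (simp add: Q_def linear_0[OF lin])
  define y where "y = m *\<^sub>R x - T x"
  have yV: "y \<in> V"
    using V xV by (auto simp: y_def image_subset_iff intro: subspace_diff subspace_scale)
  have exp: "Q (x + t *\<^sub>R y) = 2 * t * (y \<bullet> y) + t^2 * Q y" for t
  proof -
    have "T y \<bullet> x = y \<bullet> T x" by (rule sym)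
    then have "Q (x + t *\<^sub>R y) = (m * (x \<bullet> x) - T x \<bullet> x) + 2 * t * (m * (x \<bullet> y) - T x \<bullet> y) + t^2 * Q y"
      by (simp add: Q_def linear_add[OF lin] linear_scale[OF lin] inner_add_left inner_add_right
          inner_commute power2_eq_square algebra_simps)
    also have "m * (x \<bullet> y) - T x \<bullet> y = y \<bullet> y"
      unfolding y_def by (simp add: inner_diff_left inner_diff_right algebra_simps)
    finally show ?thesis by (simp add: m_def xV)
  qed
  have "y = 0"
  proof (rule ccontr)
    assume "y \<noteq> 0"
    then have p: "y \<bullet> y > 0" by simp
    define q where "q = Q y"
    have q: "q \<ge> 0" using Q yV by (simp add: q_def)
    \<comment> \<open>The form on the line \<open>x + t y\<close> is \<open>2 t (y \<bullet> y) + t\<^sup>2 q\<close>; this \<open>t\<close> makes it negative.\<close>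
    define t where "t = - (y \<bullet> y) / (q + 1)"
    have t: "y \<bullet> y = - t * (q + 1)" "t \<noteq> 0"
      using q p by (auto simp: t_def)
    have "2 * t * (y \<bullet> y) + t^2 * q \<ge> 0"
      using Q[of "x + t *\<^sub>R y"] exp[of t] yV xV V(1) by (simp add: q_def subspace_add subspace_scale)
    moreover have "2 * t * (y \<bullet> y) + t^2 * q = - (t^2 * (q + 2))"
      unfolding t(1) by (simp add: power2_eq_square algebra_simps)
    moreover have "t^2 * (q + 2) > 0"
      using q t by (intro mult_pos_pos) auto
    ultimately show False by simp
  qed
  then have "T x = m *\<^sub>R x" by (simp add: y_def)
  then show ?thesis using xV that by blast
qed

text \<open>The orthogonal complement of an eigenvector inside an invariant subspace is invariant again,
  which gives an induction on the dimension.\<close>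

lemma spectral_theorem_subspace:
  fixes T :: "'a::euclidean_space \<Rightarrow> 'a"
  assumes lin: "linear T" and sym: "\<And>x y. T x \<bullet> y = x \<bullet> T y"
    and V: "subspace V" "T ` V \<subseteq> V"
  shows "\<exists>B \<subseteq> V. pairwise orthogonal B \<and> (\<forall>b\<in>B. norm b = 1 \<and> (\<exists>l. T b = l *\<^sub>R b)) \<and> span B = V"
  using V
proof (induction "dim V" arbitrary: V rule: less_induct)
  case less
  show ?case
  proof (cases "V = {0}")
    case True
    then show ?thesis by (intro exI[of _ "{}"]) auto
  next
    case False
    then obtain x l where x: "x \<in> V" "norm x = 1" "T x = l *\<^sub>R x"
      using symmetric_eigenvector_exists[OF lin sym less.prems] by blast
    have xx: "x \<bullet> x = 1" using x by (simp add: dot_square_norm)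
    define W where "W = V \<inter> {y. orthogonal x y}"
    have W: "subspace W"
      unfolding W_def by (intro subspace_inter less.prems subspace_orthogonal_to_vector)
    have "T ` W \<subseteq> W"
      using less.prems x by (auto simp: W_def orthogonal_def simp flip: sym)
    moreover have "dim W < dim V"
    proof -
      have "x \<notin> W" using xx by (simp add: W_def orthogonal_def)
      then have "W \<subset> V" using x by (auto simp: W_def)
      then show ?thesis
        using W less.prems by (metis dim_psubset span_eq_iff)
    qed
    ultimately obtain B where B: "B \<subseteq> W" "pairwise orthogonal B"
      "\<forall>b\<in>B. norm b = 1 \<and> (\<exists>l. T b = l *\<^sub>R b)" "span B = W"
      using less.hyps[of W] W by blast
    have "span (insert x B) = V"
    proof
      show "span (insert x B) \<subseteq> V"
        using B x less.prems by (intro span_minimal) (auto simp: W_def)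
      show "V \<subseteq> span (insert x B)"
      proof
        fix y assume y: "y \<in> V"
        have "y - (x \<bullet> y) *\<^sub>R x \<in> W"
          using y x xx less.prems
          by (auto simp: W_def orthogonal_def inner_diff_right intro: subspace_diff subspace_scale)
        then show "y \<in> span (insert x B)"
          using B(4) span_breakdown_eq by blast
      qed
    qed
    moreover have "pairwise orthogonal (insert x B)"
      using B by (auto simp: pairwise_insert W_def orthogonal_commute)
    ultimately show ?thesis
      using B x by (intro exI[of _ "insert x B"]) (auto simp: W_def)
  qed
qed

text \<open>The right-hand side is the shape in which \<^const>\<open>singular_values\<close> counts eigenvalues with
  multiplicity.\<close>

lemma image_mset_eq_sum_replicate:
  assumes "finite B"
  shows "image_mset h (mset_set B) = (\<Sum>l\<in>h ` B. replicate_mset (card {b\<in>B. h b = l}) l)"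
proof (rule multiset_eqI)
  fix y
  have "count (\<Sum>l\<in>h ` B. replicate_mset (card {b\<in>B. h b = l}) l) y
      = (\<Sum>l\<in>h ` B. if l = y then card {b\<in>B. h b = l} else 0)"
    by (auto simp: count_sum intro!: sum.cong)
  also have "\<dots> = (if y \<in> h ` B then card {b\<in>B. h b = y} else 0)"
    using assms by (simp add: sum.delta)
  also have "\<dots> = card {b\<in>B. h b = y}"
    using assms by (auto simp: card_eq_0_iff)
  finally show "count (image_mset h (mset_set B)) y
      = count (\<Sum>l\<in>h ` B. replicate_mset (card {b\<in>B. h b = l}) l) y"
    using assms by (simp add: count_image_mset' sum.If_cases) (metis)
qed

lemma eigenspace_orthonormal_eigenbasis:
  fixes T :: "'a::euclidean_space \<Rightarrow> 'a"
  assumes lin: "linear T" and B: "finite B" "pairwise orthogonal B" "\<And>b. b \<in> B \<Longrightarrow> norm b = 1"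
    "span B = UNIV" and ev: "\<And>b. b \<in> B \<Longrightarrow> T b = h b *\<^sub>R b"
  shows "eigenspace T l = span {b\<in>B. h b = l}"
proof
  show "eigenspace T l \<subseteq> span {b\<in>B. h b = l}"
  proof
    fix x assume x: "x \<in> eigenspace T l"
    have exp: "y = (\<Sum>b\<in>B. (b \<bullet> y) *\<^sub>R b)" for y
      using orthonormal_basis_expand[OF B(2,3) _ B(1), of y] B(4) by (simp add: inner_commute)
    have coeff: "b \<bullet> x = 0" if b: "b \<in> B" "h b \<noteq> l" for b
    proof -
      have "T x = (\<Sum>b\<in>B. (b \<bullet> x) *\<^sub>R T b)"
        by (subst exp[of x]) (simp add: linear_sum[OF lin] linear_scale[OF lin])
      also have "\<dots> = (\<Sum>b\<in>B. (b \<bullet> x * h b) *\<^sub>R b)"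
        by (intro sum.cong) (auto simp: ev)
      finally have "b \<bullet> T x = (\<Sum>a\<in>B. (a \<bullet> x * h a) * (b \<bullet> a))"
        by (simp add: inner_sum_right)
      also have "\<dots> = (\<Sum>a\<in>B. if a = b then b \<bullet> x * h b else 0)"
        using B b by (intro sum.cong) (auto simp: pairwise_def orthogonal_def dot_square_norm)
      also have "\<dots> = b \<bullet> x * h b" using B b by simp
      also have "T x = l *\<^sub>R x" using x by (simp add: eigenspace_def)
      finally show ?thesis using b by (simp add: mult.commute)
    qed
    have "x = (\<Sum>b\<in>{b\<in>B. h b = l}. (b \<bullet> x) *\<^sub>R b)"
      by (subst exp[of x], rule sum.mono_neutral_right) (use B coeff in auto)
    then show "x \<in> span {b\<in>B. h b = l}"
      by (metis (no_types, lifting) span_base span_scale span_sum)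
  qed
  have "subspace (eigenspace T l)"
    by (auto simp: eigenspace_def subspace_def linear_0[OF lin] linear_add[OF lin] linear_scale[OF lin]
        scaleR_add_right)
  then show "span {b\<in>B. h b = l} \<subseteq> eigenspace T l"
    by (intro span_minimal) (auto simp: eigenspace_def ev)
qed

text \<open>An orthonormal eigenbasis of \<open>f\<^sup>* f\<close> is mapped by \<open>f\<close> to orthogonal vectors, because
  \<open>f a \<bullet> f b = f\<^sup>* f a \<bullet> b\<close>; and the norm of \<open>f b\<close> is the square root of the eigenvalue of \<open>b\<close>.\<close>

lemma singular_values_eigenbasis:
  fixes f :: "'a::euclidean_space \<Rightarrow> 'a"
  assumes lin: "linear f"
  obtains B where "finite B" "card B = DIM('a)" "pairwise orthogonal B" "span B = UNIV"
    "\<And>b. b \<in> B \<Longrightarrow> norm b = 1"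
    "\<And>a b. a \<in> B \<Longrightarrow> b \<in> B \<Longrightarrow> a \<noteq> b \<Longrightarrow> f a \<bullet> f b = 0"
    "singular_values f = image_mset (\<lambda>b. norm (f b)) (mset_set B)"
proof -
  define T where "T = adjoint f \<circ> f"
  have T: "T x \<bullet> y = f x \<bullet> f y" "x \<bullet> T y = f x \<bullet> f y" for x y
    using adjoint_works[OF lin] by (simp_all add: T_def inner_commute)
  have linT: "linear T"
    unfolding T_def using lin adjoint_linear[OF lin] by (rule linear_compose)
  obtain B where B: "pairwise orthogonal B" "\<And>b. b \<in> B \<Longrightarrow> norm b = 1"
    "\<And>b. b \<in> B \<Longrightarrow> \<exists>l. T b = l *\<^sub>R b" "span B = UNIV"
    using spectral_theorem_subspace[OF linT, of UNIV] T by auto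
  have "0 \<notin> B" using B(2) by fastforce
  then have ind: "independent B" using B(1) by (rule pairwise_orthogonal_independent[rotated])
  then have fin: "finite B" by (rule independent_imp_finite)
  have card: "card B = DIM('a)"
    using ind B(4) by (metis dim_UNIV dim_span_eq_card_independent)
  define h where "h b = (norm (f b))^2" for b
  have ev: "T b = h b *\<^sub>R b" if b: "b \<in> B" for b
  proof -
    obtain l where l: "T b = l *\<^sub>R b" using B(3) b by blast
    have "l = T b \<bullet> b" using B(2)[OF b] by (simp add: l dot_square_norm)
    then have "l = h b" by (simp add: T h_def dot_square_norm)
    then show ?thesis using l by simp
  qed
  have eig: "eigenspace T l = span {b\<in>B. h b = l}" for l
    by (rule eigenspace_orthonormal_eigenbasis[OF linT fin B(1,2,4) ev])
  have dim: "dim (eigenspace T l) = card {b\<in>B. h b = l}" for l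
    unfolding eig by (rule dim_span_eq_card_independent) (rule independent_mono[OF ind], auto)
  have ne: "eigenspace T l \<noteq> {0} \<longleftrightarrow> l \<in> h ` B" for l
  proof -
    have "eigenspace T l = {0} \<longleftrightarrow> {b\<in>B. h b = l} \<subseteq> {0}"
      unfolding eig using span_minimal[of "{b\<in>B. h b = l}" "{0}"] span_superset[of "{b\<in>B. h b = l}"]
        span_0[of "{b\<in>B. h b = l}"] by auto
    also have "\<dots> \<longleftrightarrow> l \<notin> h ` B"
      using \<open>0 \<notin> B\<close> by auto
    finally show ?thesis by blast
  qed
  have "singular_values f = (\<Sum>l\<in>h ` B. replicate_mset (card {b\<in>B. h b = l}) (sqrt l))"
    unfolding singular_values_def T_def[symmetric] ne dim by simp
  also have "\<dots> = (\<Sum>l\<in>h ` B. image_mset sqrt (replicate_mset (card {b\<in>B. h b = l}) l))"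
    by simp
  also have "\<dots> = image_mset sqrt (\<Sum>l\<in>h ` B. replicate_mset (card {b\<in>B. h b = l}) l)"
    using sum_comp_morphism[of "image_mset sqrt" "\<lambda>l. replicate_mset (card {b\<in>B. h b = l}) l" "h ` B"]
    by (simp add: o_def)
  also have "\<dots> = image_mset sqrt (image_mset h (mset_set B))"
    unfolding image_mset_eq_sum_replicate[OF fin] ..
  also have "\<dots> = image_mset (\<lambda>b. norm (f b)) (mset_set B)"
    by (simp add: multiset.map_comp o_def h_def)
  finally have sv: "singular_values f = image_mset (\<lambda>b. norm (f b)) (mset_set B)" .
  have orth: "f a \<bullet> f b = 0" if "a \<in> B" "b \<in> B" "a \<noteq> b" for a b
  proof -
    have "f a \<bullet> f b = T a \<bullet> b" by (simp add: T)
    also have "\<dots> = h a * (a \<bullet> b)" by (simp add: ev that)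
    finally show ?thesis using that B(1) by (simp add: pairwise_def orthogonal_def)
  qed
  show ?thesis by (rule that[OF fin card B(1,4,2) orth sv])
qed

text \<open>An orthonormal basis of right singular vectors, indexed from \<open>1\<close> as the singular values are.\<close>

definition singular_basis :: "('a::euclidean_space \<Rightarrow> 'a) \<Rightarrow> (nat \<Rightarrow> 'a) \<Rightarrow> bool" where
  "singular_basis f v \<longleftrightarrow>
     (\<forall>i\<in>{1..DIM('a)}. \<forall>j\<in>{1..DIM('a)}. v i \<bullet> v j = (if i = j then 1 else 0) \<and>
        f (v i) \<bullet> f (v j) = (if i = j then (singular_value i f)\<^sup>2 else 0)) \<and>
     (\<forall>x. x = (\<Sum>i=1..DIM('a). (v i \<bullet> x) *\<^sub>R v i))"

lemma singular_value_decomposition: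
  fixes f :: "'a::euclidean_space \<Rightarrow> 'a"
  assumes lin: "linear f"
  shows "\<exists>v. singular_basis f v"
    and singular_value_antimono:
      "\<lbrakk>1 \<le> i; i \<le> j; j \<le> DIM('a)\<rbrakk> \<Longrightarrow> singular_value j f \<le> singular_value i f"
    and singular_value_nonneg: "i \<in> {1..DIM('a)} \<Longrightarrow> 0 \<le> singular_value i f"
proof -
  obtain B where B: "finite B" "card B = DIM('a)" "pairwise orthogonal B" "span B = UNIV"
    "\<And>b. b \<in> B \<Longrightarrow> norm b = 1"
    "\<And>a b. a \<in> B \<Longrightarrow> b \<in> B \<Longrightarrow> a \<noteq> b \<Longrightarrow> f a \<bullet> f b = 0"
    "singular_values f = image_mset (\<lambda>b. norm (f b)) (mset_set B)"
    using singular_values_eigenbasis[OF lin] by blast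
  obtain xs where xs: "set xs = B" "distinct xs"
    using finite_distinct_list[OF B(1)] by blast
  \<comment> \<open>Singular values are read off a decreasing list, so the basis is listed in the same order.\<close>
  define ys where "ys = rev (sort_key (\<lambda>b. norm (f b)) xs)"
  define v where "v i = ys ! (i - 1)" for i
  have ys: "set ys = B" "distinct ys" using xs by (auto simp: ys_def)
  then have len: "length ys = DIM('a)" using B(2) by (metis distinct_card)
  have "mset_set B = mset xs" using xs by (metis mset_set_set)
  then have "sorted_list_of_multiset (singular_values f) = sort (map (\<lambda>b. norm (f b)) xs)"
    unfolding B(7) by (simp flip: mset_map)
  also have "\<dots> = map (\<lambda>b. norm (f b)) (sort_key (\<lambda>b. norm (f b)) xs)"
    by (intro properties_for_sort) auto
  finally have sv: "rev (sorted_list_of_multiset (singular_values f)) = map (\<lambda>b. norm (f b)) ys"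
    by (simp add: ys_def rev_map)
  have sorted: "sorted (rev (map (\<lambda>b. norm (f b)) ys))"
    unfolding sv[symmetric] by simp
  have val: "singular_value i f = norm (f (v i))" if "i \<in> {1..DIM('a)}" for i
    using that len by (auto simp: singular_value_def sv v_def)
  have vB: "v i \<in> B" if "i \<in> {1..DIM('a)}" for i
    using that len ys by (auto simp: v_def)
  have inj: "v i = v j \<longleftrightarrow> i = j" if "i \<in> {1..DIM('a)}" "j \<in> {1..DIM('a)}" for i j
    using that len ys by (auto simp: v_def nth_eq_iff_index_eq)
  have img: "v ` {1..DIM('a)} = B"
  proof (rule card_subset_eq[OF B(1)])
    show "card (v ` {1..DIM('a)}) = card B"
      unfolding B(2) by (subst card_image) (auto simp: inj_on_def inj)
  qed (use vB in auto)
  have "singular_basis f v"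
    unfolding singular_basis_def
  proof (intro conjI ballI allI)
    fix i j assume ij: "i \<in> {1..DIM('a)}" "j \<in> {1..DIM('a)}"
    show "v i \<bullet> v j = (if i = j then 1 else 0)"
      using B(3,5) vB[OF ij(1)] vB[OF ij(2)] inj[OF ij]
      by (auto simp: pairwise_def orthogonal_def dot_square_norm)
    show "f (v i) \<bullet> f (v j) = (if i = j then (singular_value i f)\<^sup>2 else 0)"
      using B(6) vB[OF ij(1)] vB[OF ij(2)] inj[OF ij] val[OF ij(1)] by (auto simp: dot_square_norm)
  next
    fix x
    have "x = (\<Sum>b\<in>B. (b \<bullet> x) *\<^sub>R b)"
      using orthonormal_basis_expand[OF B(3,5) _ B(1), of x] B(4) by (simp add: inner_commute)
    also have "\<dots> = (\<Sum>i=1..DIM('a). (v i \<bullet> x) *\<^sub>R v i)"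
      unfolding img[symmetric] by (subst sum.reindex) (auto simp: inj_on_def inj)
    finally show "x = (\<Sum>i=1..DIM('a). (v i \<bullet> x) *\<^sub>R v i)" .
  qed
  then show "\<exists>v. singular_basis f v" by blast
  show "singular_value j f \<le> singular_value i f" if "1 \<le> i" "i \<le> j" "j \<le> DIM('a)"
    using that sorted_rev_nth_mono[OF sorted, of "i - 1" "j - 1"] len val[of i] val[of j]
    by (simp add: v_def)
  show "0 \<le> singular_value i f" if "i \<in> {1..DIM('a)}"
    using that by (simp add: val)
qed

section \<open>Operator norms and the top singular direction\<close>

lemma bounded_linear_of_linear:
  fixes f :: "'a::euclidean_space \<Rightarrow> 'b::real_normed_vector"
  shows "linear f \<Longrightarrow> bounded_linear f"
  by (rule linear_conv_bounded_linear[THEN iffD1])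

lemma singular_basis_inner:
  fixes f :: "'a::euclidean_space \<Rightarrow> 'a"
  assumes "singular_basis f v" "i \<in> {1..DIM('a)}" "j \<in> {1..DIM('a)}"
  shows "v i \<bullet> v j = (if i = j then 1 else 0)"
    and "f (v i) \<bullet> f (v j) = (if i = j then (singular_value i f)\<^sup>2 else 0)"
  using assms unfolding singular_basis_def by blast+

lemma singular_basis_expansion:
  fixes f :: "'a::euclidean_space \<Rightarrow> 'a"
  assumes lin: "linear f" and v: "singular_basis f v"
  shows "x \<bullet> y = (\<Sum>i=1..DIM('a). (v i \<bullet> x) * (v i \<bullet> y))"
    and "f x \<bullet> f y = (\<Sum>i=1..DIM('a). (singular_value i f)\<^sup>2 * ((v i \<bullet> x) * (v i \<bullet> y)))"
proof -
  have exp: "x = (\<Sum>i=1..DIM('a). (v i \<bullet> x) *\<^sub>R v i)" for x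
    using v unfolding singular_basis_def by blast
  note fv = singular_basis_inner(2)[OF v]
  let ?I = "{1..DIM('a)}"
  have "x \<bullet> y = (\<Sum>i\<in>?I. (v i \<bullet> x) *\<^sub>R v i) \<bullet> y"
    by (subst exp[of x]) simp
  then show "x \<bullet> y = (\<Sum>i\<in>?I. (v i \<bullet> x) * (v i \<bullet> y))"
    by (simp add: inner_sum_left)
  have "f x \<bullet> f y = (\<Sum>i\<in>?I. (v i \<bullet> x) *\<^sub>R f (v i)) \<bullet> (\<Sum>j\<in>?I. (v j \<bullet> y) *\<^sub>R f (v j))"
    by (subst exp[of x], subst exp[of y]) (simp add: linear_sum[OF lin] linear_scale[OF lin])
  also have "\<dots> = (\<Sum>i\<in>?I. \<Sum>j\<in>?I. if j = i then (singular_value i f)\<^sup>2 * ((v i \<bullet> x) * (v i \<bullet> y)) else 0)"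
    unfolding inner_sum_left inner_sum_right
    by (intro sum.cong refl) (simp add: fv)
  finally show "f x \<bullet> f y = (\<Sum>i\<in>?I. (singular_value i f)\<^sup>2 * ((v i \<bullet> x) * (v i \<bullet> y)))"
    by simp
qed

lemma singular_value_1:
  fixes f :: "'a::euclidean_space \<Rightarrow> 'a"
  assumes lin: "linear f"
  shows "singular_value 1 f = onorm f"
proof -
  obtain v where v: "singular_basis f v"
    using singular_value_decomposition(1)[OF lin] by blast
  note mono = singular_value_antimono[OF lin] and nn = singular_value_nonneg[OF lin]
  note E = singular_basis_expansion[OF lin v]
  have 1: "1 \<in> {1..DIM('a)}" using DIM_positive[where 'a='a] by (simp add: Suc_leI)
  show ?thesis
  proof (rule antisym)
    have "norm (f (v 1)) = singular_value 1 f"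
      using singular_basis_inner(2)[OF v 1 1] nn[OF 1] by (simp add: norm_eq_sqrt_inner)
    moreover have "norm (v 1) = 1" using singular_basis_inner(1)[OF v 1 1] by (simp add: norm_eq_sqrt_inner)
    ultimately show "singular_value 1 f \<le> onorm f"
      using onorm[OF bounded_linear_of_linear[OF lin], of "v 1"] by simp
    show "onorm f \<le> singular_value 1 f"
    proof (rule onorm_le)
      fix x
      have "(norm (f x))\<^sup>2 = (\<Sum>i=1..DIM('a). (singular_value i f)\<^sup>2 * ((v i \<bullet> x) * (v i \<bullet> x)))"
        unfolding power2_norm_eq_inner by (rule E)
      also have "\<dots> \<le> (\<Sum>i=1..DIM('a). (singular_value 1 f)\<^sup>2 * ((v i \<bullet> x) * (v i \<bullet> x)))"
        using mono nn by (intro sum_mono mult_right_mono power_mono) auto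
      also have "\<dots> = (singular_value 1 f * norm x)\<^sup>2"
        by (simp add: power_mult_distrib power2_norm_eq_inner E(1)[of x x] sum_distrib_left)
      finally show "norm (f x) \<le> singular_value 1 f * norm x"
        by (rule power2_le_imp_le) (use nn[OF 1] in auto)
    qed
  qed
qed

lemma singular_value_1_ge_2:
  fixes f :: "'a::euclidean_space \<Rightarrow> 'a"
  assumes lin: "linear f" and "DIM('a) \<ge> 2"
  shows "0 \<le> singular_value 2 f" "singular_value 2 f \<le> onorm f"
  using singular_value_antimono[OF lin, of 1 2] singular_value_nonneg[OF lin, of 2] assms(2)
  unfolding singular_value_1[OF lin, symmetric] by auto

text \<open>The axis \<^const>\<open>major_axis\<close> is defined by an arbitrary maximiser \<open>w\<close> of the norm on the ellipsoid,
  not by the first vector of a singular basis. Since \<open>w\<close> attains the norm, its coefficient along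
  the \<open>i\<close>-th singular vector vanishes unless the \<open>i\<close>-th singular value equals the first. If
  the second singular value equals the first, the bound is the trivial one; otherwise \<open>w\<close> is the
  first singular vector up to sign.\<close>

lemma orthogonal_to_top_direction:
  fixes f :: "'a::euclidean_space \<Rightarrow> 'a"
  assumes lin: "linear f" and d: "DIM('a) \<ge> 2"
    and w: "norm w = 1" "norm (f w) = onorm f" and x: "w \<bullet> x = 0"
  shows "norm (f x) \<le> singular_value 2 f * norm x" "f w \<bullet> f x = 0"
proof -
  obtain v where v: "singular_basis f v"
    using singular_value_decomposition(1)[OF lin] by blast
  note mono = singular_value_antimono[OF lin] and nn = singular_value_nonneg[OF lin]
  note E = singular_basis_expansion[OF lin v]
  let ?s = "\<lambda>i. singular_value i f"
  have sq: "(?s i)\<^sup>2 \<le> (?s 1)\<^sup>2" if "i \<in> {1..DIM('a)}" for i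
    using that mono nn by (intro power_mono) auto
  have "(\<Sum>i=1..DIM('a). ((?s 1)\<^sup>2 - (?s i)\<^sup>2) * (v i \<bullet> w)\<^sup>2)
      = (?s 1)\<^sup>2 * (w \<bullet> w) - f w \<bullet> f w"
    unfolding E[of w w] by (simp add: sum_distrib_left sum_subtractf power2_eq_square algebra_simps)
  also have "\<dots> = 0"
    using w unfolding singular_value_1[OF lin] by (simp add: dot_square_norm)
  finally have z: "((?s 1)\<^sup>2 - (?s i)\<^sup>2) * (v i \<bullet> w)\<^sup>2 = 0" if "i \<in> {1..DIM('a)}" for i
    using that sq by (subst (asm) sum_nonneg_eq_0_iff) auto
  have "f w \<bullet> f x = (\<Sum>i=1..DIM('a). (?s 1)\<^sup>2 * ((v i \<bullet> w) * (v i \<bullet> x)))"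
    unfolding E(2)
  proof (rule sum.cong[OF refl])
    fix i assume "i \<in> {1..DIM('a)}"
    then have "(?s 1)\<^sup>2 - (?s i)\<^sup>2 = 0 \<or> (v i \<bullet> w)\<^sup>2 = 0"
      using z[of i] unfolding mult_eq_0_iff by blast
    then show "(?s i)\<^sup>2 * ((v i \<bullet> w) * (v i \<bullet> x)) = (?s 1)\<^sup>2 * ((v i \<bullet> w) * (v i \<bullet> x))"
    proof
      assume "(?s 1)\<^sup>2 - (?s i)\<^sup>2 = 0"
      then have "(?s i)\<^sup>2 = (?s 1)\<^sup>2" by linarith
      then show ?thesis by (simp only:)
    qed simp
  qed
  also have "\<dots> = (?s 1)\<^sup>2 * (w \<bullet> x)" unfolding E(1)[of w x] by (simp add: sum_distrib_left)
  finally show "f w \<bullet> f x = 0" using x by simp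
  show "norm (f x) \<le> ?s 2 * norm x"
  proof (cases "?s 2 = ?s 1")
    case True
    then show ?thesis
      using onorm[OF bounded_linear_of_linear[OF lin], of x] unfolding singular_value_1[OF lin] by simp
  next
    case False
    have vw: "v i \<bullet> w = 0" if "i \<in> {2..DIM('a)}" for i
    proof -
      have "?s i \<le> ?s 2" "?s 2 \<le> ?s 1" "0 \<le> ?s i" using that mono nn by auto
      then have "(?s i)\<^sup>2 < (?s 1)\<^sup>2" using False by (intro power_strict_mono) auto
      then show ?thesis using z[of i] that by auto
    qed
    have split: "{1..DIM('a)} = insert 1 {2..DIM('a)}" using d by auto
    have first: "w \<bullet> y = (v 1 \<bullet> w) * (v 1 \<bullet> y)" for y
      by (subst E(1), subst split) (simp add: vw)
    have "v 1 \<bullet> w \<noteq> 0" using first[of w] w by (auto simp: dot_square_norm)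
    then have vx: "v 1 \<bullet> x = 0" using x first[of x] by simp
    have "(norm (f x))\<^sup>2 = (\<Sum>i=1..DIM('a). (?s i)\<^sup>2 * ((v i \<bullet> x) * (v i \<bullet> x)))"
      unfolding power2_norm_eq_inner by (rule E)
    also have "\<dots> \<le> (\<Sum>i=1..DIM('a). (?s 2)\<^sup>2 * ((v i \<bullet> x) * (v i \<bullet> x)))"
    proof (rule sum_mono)
      fix i assume i: "i \<in> {1..DIM('a)}"
      show "(?s i)\<^sup>2 * ((v i \<bullet> x) * (v i \<bullet> x)) \<le> (?s 2)\<^sup>2 * ((v i \<bullet> x) * (v i \<bullet> x))"
      proof (cases "i = 1")
        case False
        then show ?thesis using i mono[of 2 i] nn[of i] by (intro mult_right_mono power_mono) auto
      qed (use vx in simp)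
    qed
    also have "\<dots> = (?s 2 * norm x)\<^sup>2"
      by (simp add: power_mult_distrib power2_norm_eq_inner E(1)[of x x] sum_distrib_left)
    finally show ?thesis by (rule power2_le_imp_le) (use nn[of 2] d in auto)
  qed
qed

lemma top_direction_exists:
  fixes f :: "'a::euclidean_space \<Rightarrow> 'a"
  assumes lin: "linear f"
  obtains w where "norm w = 1" "norm (f w) = onorm f"
proof -
  obtain v where v: "singular_basis f v"
    using singular_value_decomposition(1)[OF lin] by blast
  note mono = singular_value_antimono[OF lin] and nn = singular_value_nonneg[OF lin]
  have 1: "1 \<in> {1..DIM('a)}" using DIM_positive[where 'a='a] by (simp add: Suc_leI)
  show ?thesis
  proof (rule that[of "v 1"])
    show "norm (v 1) = 1" using singular_basis_inner(1)[OF v 1 1] by (simp add: norm_eq_sqrt_inner)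
    show "norm (f (v 1)) = onorm f"
      using singular_basis_inner(2)[OF v 1 1] nn[OF 1] by (simp add: norm_eq_sqrt_inner flip: singular_value_1[OF lin])
  qed
qed

text \<open>A linear map is the rank one map through its top direction \<open>w\<close> up to an error \<open>x \<mapsto> f y\<close> of
  size the second singular value.\<close>

lemma top_direction_decomposition:
  fixes f :: "'a::euclidean_space \<Rightarrow> 'a"
  assumes lin: "linear f" and d: "DIM('a) \<ge> 2"
    and w: "norm w = 1" "norm (f w) = onorm f"
  obtains y where "x = (w \<bullet> x) *\<^sub>R w + y" "f x = (w \<bullet> x) *\<^sub>R f w + f y"
    "norm (f y) \<le> singular_value 2 f * norm x" "\<bar>w \<bullet> x\<bar> \<le> norm x"
proof -
  define y where "y = x - (w \<bullet> x) *\<^sub>R w"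
  have ww: "w \<bullet> w = 1" using w by (simp add: dot_square_norm)
  then have wy: "w \<bullet> y = 0" by (simp add: y_def inner_diff_right dot_square_norm)
  have "norm y \<le> norm x"
  proof (rule power2_le_imp_le)
    have "(norm x)\<^sup>2 = (w \<bullet> x)\<^sup>2 + (norm y)\<^sup>2"
      using ww unfolding power2_norm_eq_inner y_def
      by (simp add: inner_diff_left inner_diff_right inner_commute power2_eq_square)
    then show "(norm y)\<^sup>2 \<le> (norm x)\<^sup>2" by simp
  qed simp
  then have "norm (f y) \<le> singular_value 2 f * norm x"
    using orthogonal_to_top_direction(1)[OF lin d w wy] singular_value_1_ge_2(1)[OF lin d]
    by (meson mult_left_mono order_trans)
  moreover have "\<bar>w \<bullet> x\<bar> \<le> norm x" using Cauchy_Schwarz_ineq2[of w x] w by simp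
  moreover have "x = (w \<bullet> x) *\<^sub>R w + y" by (simp add: y_def)
  moreover have "f x = (w \<bullet> x) *\<^sub>R f w + f y"
    by (simp add: y_def linear_diff[OF lin] linear_scale[OF lin])
  ultimately show ?thesis by (rule that[rotated 2])
qed

text \<open>If \<open>B\<close> has rank one, then \<open>onorm (A \<circ> B) * onorm (B \<circ> C) = onorm (A \<circ> B \<circ> C) * onorm B\<close>. In
  general \<open>B\<close> differs from the rank one map through its top direction by an error of norm
  \<open>singular_value 2 B\<close>, and the last summand pays for this error in each of the three products.\<close>

lemma onorm_three_factors:
  fixes A B C :: "'a::euclidean_space \<Rightarrow> 'a"
  assumes lin: "linear A" "linear B" "linear C" and d: "DIM('a) \<ge> 2"
  shows "onorm (A \<circ> B) * onorm (B \<circ> C)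
    \<le> onorm (A \<circ> B \<circ> C) * onorm B + 4 * (onorm A * onorm B * onorm C * singular_value 2 B)"
proof -
  note bl = lin[THEN bounded_linear_of_linear]
  note A = onorm[OF bl(1)] and B = onorm[OF bl(2)] and C = onorm[OF bl(3)]
  note nn = onorm_pos_le[OF bl(1)] onorm_pos_le[OF bl(2)] onorm_pos_le[OF bl(3)]
  obtain w where w: "norm w = 1" "norm (B w) = onorm B" using top_direction_exists[OF lin(2)] .
  define s where "s = singular_value 2 B"
  have s: "0 \<le> s" "s \<le> onorm B" using singular_value_1_ge_2[OF lin(2) d] by (auto simp: s_def)
  \<comment> \<open>For the rank one part \<open>x \<mapsto> (w \<bullet> x) B w\<close> of \<open>B\<close>, the products \<open>A B\<close>, \<open>B C\<close> and \<open>A B C\<close> have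
    norms \<open>p\<close>, \<open>k onorm B\<close> and \<open>p k\<close>.\<close>
  define p where "p = norm (A (B w))"
  define k where "k = onorm (\<lambda>x. w \<bullet> C x)"
  have lk: "bounded_linear (\<lambda>x. w \<bullet> C x)" using bounded_linear_compose[OF bounded_linear_inner_right bl(3)] .
  have p: "0 \<le> p" "p \<le> onorm A * onorm B" using A[of "B w"] w by (auto simp: p_def)
  have "\<bar>w \<bullet> C x\<bar> \<le> onorm C * norm x" for x
    using Cauchy_Schwarz_ineq2[of w "C x"] C[of x] w by simp
  then have k: "0 \<le> k" "k \<le> onorm C"
    unfolding k_def by (auto intro!: onorm_le onorm_pos_le lk)
  have AB: "onorm (A \<circ> B) \<le> p + onorm A * s"
  proof (rule onorm_le)
    fix x
    obtain y where y: "B x = (w \<bullet> x) *\<^sub>R B w + B y" "norm (B y) \<le> s * norm x" "\<bar>w \<bullet> x\<bar> \<le> norm x"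
      using top_direction_decomposition[OF lin(2) d w] unfolding s_def by blast
    have "norm ((A \<circ> B) x) = norm ((w \<bullet> x) *\<^sub>R A (B w) + A (B y))"
      by (simp add: y linear_add[OF lin(1)] linear_scale[OF lin(1)])
    also have "\<dots> \<le> \<bar>w \<bullet> x\<bar> * p + norm (A (B y))"
      by (rule norm_triangle_le) (simp add: p_def)
    also have "\<dots> \<le> norm x * p + onorm A * (s * norm x)"
      using y p nn by (intro add_mono mult_right_mono order_trans[OF A] mult_left_mono) auto
    finally show "norm ((A \<circ> B) x) \<le> (p + onorm A * s) * norm x" by (simp add: algebra_simps)
  qed
  have BC: "onorm (B \<circ> C) \<le> onorm B * k + s * onorm C"
  proof (rule onorm_le)
    fix x
    obtain y where y: "B (C x) = (w \<bullet> C x) *\<^sub>R B w + B y" "norm (B y) \<le> s * norm (C x)"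
      using top_direction_decomposition[OF lin(2) d w] unfolding s_def by blast
    have "norm ((B \<circ> C) x) \<le> \<bar>w \<bullet> C x\<bar> * onorm B + norm (B y)"
      unfolding o_def y(1) by (rule norm_triangle_le) (simp add: w)
    also have "\<dots> \<le> (k * norm x) * onorm B + s * (onorm C * norm x)"
      using onorm[OF lk, of x] nn s C[of x]
      by (intro add_mono mult_right_mono order_trans[OF y(2)] mult_left_mono) (auto simp: k_def)
    finally show "norm ((B \<circ> C) x) \<le> (onorm B * k + s * onorm C) * norm x" by (simp add: algebra_simps)
  qed
  have ABC: "p * k \<le> onorm (A \<circ> B \<circ> C) + onorm A * s * onorm C" (is "_ \<le> ?R")
  proof -
    have R: "?R \<ge> 0"
      using nn s by (intro add_nonneg_nonneg mult_nonneg_nonneg onorm_pos_le bounded_linear_of_linear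
          linear_compose lin) auto
    have "onorm (\<lambda>x. p * (w \<bullet> C x)) \<le> ?R"
    proof (rule onorm_le)
      fix x
      obtain y where y: "B (C x) = (w \<bullet> C x) *\<^sub>R B w + B y" "norm (B y) \<le> s * norm (C x)"
        using top_direction_decomposition[OF lin(2) d w] unfolding s_def by blast
      have "A (B (C x)) = (w \<bullet> C x) *\<^sub>R A (B w) + A (B y)"
        by (simp add: y linear_add[OF lin(1)] linear_scale[OF lin(1)])
      then have "norm (p * (w \<bullet> C x)) = norm ((A \<circ> B \<circ> C) x - A (B y))"
        by (simp add: p_def abs_mult)
      also have "\<dots> \<le> norm ((A \<circ> B \<circ> C) x) + norm (A (B y))" by (rule norm_triangle_ineq4)
      also have "\<dots> \<le> onorm (A \<circ> B \<circ> C) * norm x + onorm A * (s * (onorm C * norm x))"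
      proof (rule add_mono)
        show "norm ((A \<circ> B \<circ> C) x) \<le> onorm (A \<circ> B \<circ> C) * norm x"
          by (intro onorm bounded_linear_of_linear linear_compose lin)
        show "norm (A (B y)) \<le> onorm A * (s * (onorm C * norm x))"
          using nn s C[of x] y(2) by (intro order_trans[OF A] mult_left_mono order_trans[OF y(2)]) auto
      qed
      finally show "norm (p * (w \<bullet> C x)) \<le> ?R * norm x"
        by (simp only: distrib_right mult.assoc)
    qed
    then show ?thesis
      using onorm_scaleR[OF lk, of p] p by (simp add: k_def)
  qed
  define a b c where "a = onorm A" and "b = onorm B" and "c = onorm C"
  have abc: "0 \<le> a" "0 \<le> b" "0 \<le> c" using nn by (auto simp: a_def b_def c_def)
  have "onorm (A \<circ> B) * onorm (B \<circ> C) \<le> (p + a * s) * (b * k + s * c)"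
    unfolding a_def b_def c_def using AB BC p nn s
    by (intro mult_mono onorm_pos_le bounded_linear_of_linear linear_compose lin) auto
  also have "\<dots> = b * (p * k) + (p * (s * c) + (a * s * b) * k + (a * s * c) * s)"
    by (simp add: algebra_simps)
  also have "\<dots> \<le> b * (onorm (A \<circ> B \<circ> C) + a * s * c) + ((a * b) * (s * c) + (a * s * b) * c + (a * s * c) * b)"
    using ABC p k abc s unfolding a_def b_def c_def
    by (intro add_mono mult_left_mono mult_right_mono mult_nonneg_nonneg) auto
  also have "\<dots> = onorm (A \<circ> B \<circ> C) * b + 4 * (a * b * c * s)" by (simp add: algebra_simps)
  finally show ?thesis by (simp add: a_def b_def c_def s_def)
qed

lemma proj_line_scaleR:
  fixes v :: "'a::euclidean_space"
  assumes "k \<noteq> 0"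
  shows "proj_line (k *\<^sub>R v) = proj_line v"
  unfolding proj_line_def span_scaled_singleton[OF assms] ..

text \<open>The sine of the angle is the distance from the unit vector along \<open>w\<close> to the line through \<open>v\<close>,
  hence at most the distance to any point of this line.\<close>

lemma dist_proj_line_le:
  fixes v w :: "'a::euclidean_space"
  assumes "v \<noteq> 0" "w \<noteq> 0"
  shows "dist (proj_line v) (proj_line w) \<le> norm (w - t *\<^sub>R v) / norm w"
proof -
  have "dist (proj_line v) (proj_line w) = sin (vec_angle (norm v *\<^sub>R sgn v) (norm w *\<^sub>R sgn w))"
    using assms by (simp add: dist_proj_line sgn_div_norm)
  also have "\<dots> = sin (vec_angle (sgn v) (sgn w))"
    using assms by (intro sin_vec_angle_scale) auto
  also have "\<dots> \<le> norm (sgn w - (t * norm v / norm w) *\<^sub>R sgn v)"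
    using assms by (intro sin_vec_angle_le) (auto simp: norm_sgn)
  also have "sgn w - (t * norm v / norm w) *\<^sub>R sgn v = (1 / norm w) *\<^sub>R (w - t *\<^sub>R v)"
    using assms by (simp add: sgn_div_norm scaleR_diff_right divide_inverse_commute)
  also have "norm \<dots> = norm (w - t *\<^sub>R v) / norm w" using assms by simp
  finally show ?thesis .
qed

text \<open>The longest vector \<open>A H x\<close> of the image ellipsoid of \<open>A H\<close> leaves the axis of \<open>A\<close> by at most
  \<open>singular_value 2 A * onorm H\<close>, while its length is at least \<open>onorm A / onorm H'\<close>: multiplying on
  the right by \<open>H\<close> moves the axis little when \<open>A\<close> has a large gap.\<close>

lemma dist_top_axes:
  fixes A H H' :: "'a::euclidean_space \<Rightarrow> 'a"
  assumes lin: "linear A" "linear H" "linear H'" and inv: "H \<circ> H' = id" "onorm A > 0" and d: "DIM('a) \<ge> 2"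
    and v: "norm v = 1" "norm (A v) = onorm A"
    and x: "norm x = 1" "norm (A (H x)) = onorm (A \<circ> H)"
  shows "dist (proj_line (A v)) (proj_line (A (H x))) \<le> onorm H * onorm H' * (singular_value 2 A / onorm A)"
proof -
  note bl = lin[THEN bounded_linear_of_linear]
  have AH0: "0 \<le> onorm (A \<circ> H)" "0 \<le> onorm H'"
    by (intro onorm_pos_le bounded_linear_of_linear linear_compose lin)+
  have "A = (A \<circ> H) \<circ> H'" using inv by (simp add: comp_assoc)
  moreover have "onorm ((A \<circ> H) \<circ> H') \<le> onorm (A \<circ> H) * onorm H'"
    by (intro onorm_compose bounded_linear_of_linear linear_compose lin)
  ultimately have A: "onorm A \<le> onorm (A \<circ> H) * onorm H'" by simp
  moreover have AH: "onorm (A \<circ> H) > 0"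
  proof (rule ccontr)
    assume "\<not> onorm (A \<circ> H) > 0"
    then have "onorm (A \<circ> H) = 0" using AH0 by simp
    then show False using A inv by simp
  qed
  ultimately have q: "1 / onorm (A \<circ> H) \<le> onorm H' / onorm A"
    using inv by (simp add: field_simps)
  obtain y where y: "A (H x) = (v \<bullet> H x) *\<^sub>R A v + A y" "norm (A y) \<le> singular_value 2 A * norm (H x)"
    using top_direction_decomposition[OF lin(1) d v] by blast
  have "A v \<noteq> 0" "A (H x) \<noteq> 0" using v x inv AH by auto
  then have "dist (proj_line (A v)) (proj_line (A (H x))) \<le> norm (A (H x) - (v \<bullet> H x) *\<^sub>R A v) / norm (A (H x))"
    by (rule dist_proj_line_le)
  also have "\<dots> = norm (A y) * (1 / onorm (A \<circ> H))" by (simp add: y(1) flip: x(2))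
  also have "\<dots> \<le> (singular_value 2 A * onorm H) * (onorm H' / onorm A)"
    using q AH onorm[OF bl(2), of x] x singular_value_1_ge_2(1)[OF lin(1) d]
    by (intro mult_mono order_trans[OF y(2)] mult_left_mono) (auto intro!: mult_nonneg_nonneg onorm_pos_le bl)
  finally show ?thesis by (simp add: mult_ac)
qed

section \<open>Coarse multiplicativity of norms\<close>

text \<open>The conditions satisfied by the operator norms \<open>N i j\<close> of the matrices \<open>a\<^sub>i\<^sup>-\<^sup>1 a\<^sub>j\<close> when
  consecutive \<open>a\<^sub>j\<close> differ by matrices of condition number at most \<open>K\<close> and the ratio of the second
  to the first singular value of \<open>a\<^sub>b\<^sup>-\<^sup>1 a\<^sub>c\<close> is at most a multiple of \<open>\<rho> ^ (c - b)\<close>; the last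
  condition is then \<open>onorm_three_factors\<close> for the products over \<open>[a, b]\<close>, \<open>[b, c]\<close> and \<open>[c, d]\<close>.\<close>

definition dominated_norms :: "real \<Rightarrow> real \<Rightarrow> real \<Rightarrow> (nat \<Rightarrow> nat \<Rightarrow> real) \<Rightarrow> bool" where
  "dominated_norms K C \<rho> N \<longleftrightarrow>
     (\<forall>i j. N i j > 0) \<and> (\<forall>j. N j j = 1) \<and> (\<forall>i j k. N i k \<le> N i j * N j k) \<and>
     (\<forall>j. N j (Suc j) * N (Suc j) j \<le> K) \<and>
     (\<forall>a b c d. a \<le> b \<longrightarrow> b \<le> c \<longrightarrow> c \<le> d \<longrightarrow>
        N a c * N b d \<le> N a d * N b c + C * \<rho> ^ (c - b) * (N a b * (N b c)\<^sup>2 * N c d))"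

text \<open>Put \<open>q a b c = N a c / (N a b * N b c)\<close>, a number in \<open>(0, 1]\<close> measuring how transverse the two
  blocks \<open>[a, b]\<close> and \<open>[b, c]\<close> are; it has to be bounded below. The last condition in
  \<^const>\<open>dominated_norms\<close>, applied with one outer block of length one, says that enlarging the blocks
  by one step lowers \<open>q\<close> by at most a constant times \<open>\<rho>\<close> to the length of the block. Summing the
  geometric series, \<open>q a b c\<close> exceeds the value \<open>q i b k\<close> of any larger blocks with the same cut
  \<open>b\<close> by at most \<open>M \<rho> ^ (b - a) + M \<rho> ^ (c - b)\<close>.

  Moving the cut by one step changes \<open>q i b k\<close> by a factor of at most \<open>K\<close>. Hence, if \<open>q i j k\<close> is
  extremely small, then all \<open>q i b k\<close> with \<open>b\<close> in a window \<open>[j, j + h]\<close> are small, and therefore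
  cutting a subinterval of length \<open>2 s\<close> of the window in the middle always loses a factor
  \<open>3 M \<rho> ^ s\<close>. Repeated bisection of the window, \<open>h\<close> being a power of \<open>2\<close>, loses \<open>\<rho> ^ (h / 2)\<close> at each
  of its \<open>log\<^sub>2 h\<close> levels, against a gain of at most a power of \<open>3 M\<close> linear in \<open>h\<close>. So
  \<open>N j (j + h)\<close> is superexponentially small in comparison with the product of its steps, whereas
  the bounded condition number of the steps allows only exponential smallness. For a
  suitable \<open>h\<close> depending on \<open>K\<close>, \<open>C\<close> and \<open>\<rho>\<close> only, this is a contradiction.\<close>

lemma coarse_multiplicativity:
  fixes K C \<rho> :: real
  assumes \<rho>: "0 < \<rho>" "\<rho> < 1" and C: "0 < C"
  shows "\<exists>\<epsilon>>0. \<forall>N i j k. dominated_norms K C \<rho> N \<longrightarrow> i \<le> j \<longrightarrow> j \<le> k \<longrightarrow> \<epsilon> * (N i j * N j k) \<le> N i k"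
proof -
  define K1 where "K1 = max K 1"
  define M where "M = max 1 (K1 * C / (1 - \<rho>))"
  have K1: "K1 \<ge> 1" "K \<le> K1" by (auto simp: K1_def)
  have M: "M \<ge> 1" "K1 * C / (1 - \<rho>) \<le> M" by (auto simp: M_def)
  \<comment> \<open>\<open>(Y r ^ t) ^ (2 ^ t)\<close> is the bound obtained below by \<open>t\<close> bisections.\<close>
  define Y where "Y = 3 * M * K1"
  have Y: "Y > 0" using M K1 by (simp add: Y_def)
  define r where "r = sqrt \<rho>"
  have r: "0 < r" "r < 1" "r\<^sup>2 = \<rho>" using \<rho> by (auto simp: r_def)
  have "(\<lambda>n. Y * r ^ n) \<longlonglongrightarrow> Y * 0"
    using r by (intro tendsto_intros LIMSEQ_realpow_zero) auto
  then have "\<forall>\<^sub>F n in sequentially. Y * r ^ n < 1"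
    by (intro order_tendstoD(2)) auto
  then obtain n where n: "Y * r ^ n < 1"
    by (auto simp: eventually_sequentially)
  define h :: nat where "h = 2 ^ n"
  define \<epsilon> where "\<epsilon> = (\<rho> / K1) ^ h"
  have \<epsilon>: "\<epsilon> > 0" "\<epsilon> * K1 ^ h = \<rho> ^ h"
    using \<rho> K1 by (auto simp: \<epsilon>_def power_divide)
  show ?thesis
  proof (intro exI[of _ \<epsilon>] conjI allI impI \<epsilon>(1))
    fix N :: "nat \<Rightarrow> nat \<Rightarrow> real" and i j k :: nat
    assume N: "dominated_norms K C \<rho> N" and ijk: "i \<le> j" "j \<le> k"
    have pos: "N i j > 0" and diag: "N j j = 1" and sub: "N i k \<le> N i j * N j k"
      and step: "N j (Suc j) * N (Suc j) j \<le> K" for i j k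
      using N unfolding dominated_norms_def by blast+
    have gap: "N a c * N b d \<le> N a d * N b c + C * \<rho> ^ (c - b) * (N a b * (N b c)\<^sup>2 * N c d)"
      if "a \<le> b" "b \<le> c" "c \<le> d" for a b c d
      using N that unfolding dominated_norms_def by blast
    note nz = pos[THEN less_imp_neq, symmetric]
    define q where "q a b c = N a c / (N a b * N b c)" for a b c
    have qpos: "q a b c > 0" for a b c using pos by (simp add: q_def)
    have step1: "N j (Suc j) * N (Suc j) j \<le> K1" for j using step[of j] K1 by linarith
    have one: "1 \<le> N a b * N b a" for a b
      using sub[of a a b] by (simp add: diag)
    \<comment> \<open>Enlarging one of the blocks by one step.\<close>
    have right1: "q a b c \<le> q a b (Suc c) + K1 * C * \<rho> ^ (c - b)" if "a \<le> b" "b \<le> c" for a b c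
    proof -
      have "q a b c = N a c * N b (Suc c) / (N a b * N b c * N b (Suc c))"
        using nz by (simp add: q_def field_simps)
      also have "\<dots> \<le> (N a (Suc c) * N b c + C * \<rho> ^ (c - b) * (N a b * (N b c)\<^sup>2 * N c (Suc c)))
          / (N a b * N b c * N b (Suc c))"
        using pos that by (intro divide_right_mono gap) (auto simp: less_imp_le)
      also have "\<dots> = q a b (Suc c) + C * \<rho> ^ (c - b) * (N b c * N c (Suc c) / N b (Suc c))"
        using nz by (simp add: q_def add_divide_distrib power2_eq_square)
      also have "N b c * N c (Suc c) / N b (Suc c) \<le> N b (Suc c) * N (Suc c) c * N c (Suc c) / N b (Suc c)"
        using pos by (intro divide_right_mono mult_right_mono sub) (auto simp: less_imp_le)
      also have "\<dots> = N c (Suc c) * N (Suc c) c" using nz by simp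
      also have "\<dots> \<le> K1" by (rule step1)
      finally show ?thesis using C \<rho> by (simp add: mult_ac)
    qed
    have left1: "q (Suc a) b c \<le> q a b c + K1 * C * \<rho> ^ (b - Suc a)" if "Suc a \<le> b" "b \<le> c" for a b c
    proof -
      have "q (Suc a) b c = N a b * N (Suc a) c / (N a b * N (Suc a) b * N b c)"
        using nz by (simp add: q_def field_simps)
      also have "\<dots> \<le> (N a c * N (Suc a) b + C * \<rho> ^ (b - Suc a) * (N a (Suc a) * (N (Suc a) b)\<^sup>2 * N b c))
          / (N a b * N (Suc a) b * N b c)"
        using pos that by (intro divide_right_mono gap) (auto simp: less_imp_le)
      also have "\<dots> = q a b c + C * \<rho> ^ (b - Suc a) * (N a (Suc a) * N (Suc a) b / N a b)"
        using nz by (simp add: q_def add_divide_distrib power2_eq_square)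
      also have "N a (Suc a) * N (Suc a) b / N a b \<le> N a (Suc a) * (N (Suc a) a * N a b) / N a b"
        using pos by (intro divide_right_mono mult_left_mono sub) (auto simp: less_imp_le)
      also have "\<dots> = N a (Suc a) * N (Suc a) a" using nz by simp
      also have "\<dots> \<le> K1" by (rule step1)
      finally show ?thesis using C \<rho> by (simp add: mult_ac)
    qed
    have geo: "K1 * C * \<rho> ^ s + M * \<rho> ^ Suc s \<le> M * \<rho> ^ s" for s
    proof -
      have "K1 * C \<le> M * (1 - \<rho>)" using M(2) \<rho> by (simp add: field_simps)
      then have "K1 * C * \<rho> ^ s \<le> M * (1 - \<rho>) * \<rho> ^ s" using \<rho> by (intro mult_right_mono) auto
      then show ?thesis by (simp add: algebra_simps)
    qed
    have right: "q a b c \<le> q a b (c + t) + M * \<rho> ^ (c - b)" if "a \<le> b" "b \<le> c" for a b c t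
      using that(2)
    proof (induction t arbitrary: c)
      case (Suc t)
      have "q a b c \<le> q a b (Suc c) + K1 * C * \<rho> ^ (c - b)" using Suc.prems that by (intro right1)
      also have "q a b (Suc c) \<le> q a b (Suc c + t) + M * \<rho> ^ (Suc c - b)"
        using Suc.prems by (intro Suc.IH) auto
      also have "Suc c - b = Suc (c - b)" using Suc.prems by auto
      finally show ?case using geo[of "c - b"] by simp
    qed (use M \<rho> in auto)
    have left: "q a b c \<le> q (a - t) b c + M * \<rho> ^ (b - a)" if "t \<le> a" "a \<le> b" "b \<le> c" for a b c t
      using that(1,2)
    proof (induction t arbitrary: a)
      case (Suc t)
      then obtain a' where a': "a = Suc a'" by (cases a) auto
      have "q a b c \<le> q a' b c + K1 * C * \<rho> ^ (b - a)"
        unfolding a' using Suc.prems that a' by (intro left1) auto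
      also have "q a' b c \<le> q (a' - t) b c + M * \<rho> ^ (b - a')"
        using Suc.prems a' by (intro Suc.IH) auto
      also have "b - a' = Suc (b - a)" using Suc.prems a' by auto
      finally show ?case using geo[of "b - a"] by (simp add: a')
    qed (use M \<rho> in auto)
    have stable: "q a b c \<le> q i b k + M * \<rho> ^ (b - a) + M * \<rho> ^ (c - b)"
      if "i \<le> a" "a \<le> b" "b \<le> c" "c \<le> k" for a b c
      using left[of "a - i" a b c] right[of i b c "k - c"] that by simp
    \<comment> \<open>The condition number of a block of length \<open>t\<close>.\<close>
    have roundtrip: "N a (a + t) * N (a + t) a \<le> K1 ^ t" for a t
    proof (induction t)
      case (Suc t)
      have "N a (a + Suc t) * N (a + Suc t) a
          \<le> (N a (a + t) * N (a + t) (a + Suc t)) * (N (a + Suc t) (a + t) * N (a + t) a)"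
        using pos by (intro mult_mono sub) (auto simp: less_imp_le)
      also have "\<dots> = (N (a + t) (Suc (a + t)) * N (Suc (a + t)) (a + t)) * (N a (a + t) * N (a + t) a)"
        by (simp add: mult_ac)
      also have "\<dots> \<le> K1 * K1 ^ t"
        using pos K1 by (intro mult_mono step1 Suc.IH) (auto simp: less_imp_le)
      finally show ?case by simp
    qed (simp add: diag)
    have \<rho>h: "\<rho> ^ h \<le> \<rho> ^ s" if "s \<le> h" for s
      using \<rho> that by (intro power_decreasing) auto
    show "\<epsilon> * (N i j * N j k) \<le> N i k"
    \<comment> \<open>A right block that does not contain the window has bounded condition number.\<close>
    proof (cases "k - j < h")
      case True
      have "N i j * N j k \<le> N i k * N k j * N j k"
        using pos by (intro mult_right_mono sub) (auto simp: less_imp_le)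
      also have "\<dots> = N i k * (N j k * N k j)" by simp
      also have "\<dots> \<le> N i k * K1 ^ (k - j)"
        using pos roundtrip[of j "k - j"] ijk by (intro mult_left_mono) (auto simp: less_imp_le)
      also have "\<dots> \<le> N i k * K1 ^ h"
        using pos K1 True by (intro mult_left_mono power_increasing) (auto simp: less_imp_le)
      finally have "\<epsilon> * (N i j * N j k) \<le> \<epsilon> * (N i k * K1 ^ h)"
        using \<epsilon> by (intro mult_left_mono) auto
      also have "\<dots> = N i k * \<rho> ^ h" unfolding \<epsilon>(2)[symmetric] by simp
      also have "\<dots> \<le> N i k" using \<rho>h[of 0] pos[of i k] by simp
      finally show ?thesis .
    next
      case False
      show ?thesis
      proof (rule ccontr)
        assume "\<not> \<epsilon> * (N i j * N j k) \<le> N i k"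
        then have small: "N i k < \<epsilon> * (N i j * N j k)" by simp
        have window: "q i a k \<le> \<rho> ^ h" if a: "j \<le> a" "a \<le> j + h" for a
        proof -
          have "N i j * N j k \<le> (N i a * N a j) * (N j a * N a k)"
            using pos by (intro mult_mono sub) (auto simp: less_imp_le)
          also have "\<dots> = N i a * N a k * (N j a * N a j)" by simp
          also have "\<dots> \<le> N i a * N a k * K1 ^ (a - j)"
            using pos roundtrip[of j "a - j"] a by (intro mult_left_mono) (auto simp: less_imp_le)
          also have "\<dots> \<le> N i a * N a k * K1 ^ h"
            using pos K1 a by (intro mult_left_mono power_increasing) (auto simp: less_imp_le)
          finally have "\<epsilon> * (N i j * N j k) \<le> \<epsilon> * (N i a * N a k * K1 ^ h)"
            using \<epsilon> by (intro mult_left_mono) auto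
          also have "\<dots> = \<rho> ^ h * (N i a * N a k)" unfolding \<epsilon>(2)[symmetric] by simp
          finally have "N i k \<le> \<rho> ^ h * (N i a * N a k)" using small by linarith
          then show ?thesis using pos by (simp add: q_def field_simps)
        qed
        have middle: "q a (a + s) (a + 2 * s) \<le> 3 * M * \<rho> ^ s"
          if a: "j \<le> a" "a + 2 * s \<le> j + h" for a s
        proof -
          have "q i (a + s) k \<le> \<rho> ^ h" using a by (intro window) auto
          also have "\<dots> \<le> \<rho> ^ s" using a by (intro \<rho>h) auto
          also have "\<dots> \<le> M * \<rho> ^ s" using M \<rho> by simp
          finally have "q i (a + s) k \<le> M * \<rho> ^ s" .
          moreover have "a + 2 * s \<le> k" using a False ijk by linarith
          ultimately show ?thesis
            using stable[of a "a + s" "a + 2 * s"] a ijk by simp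
        qed
        \<comment> \<open>The product of the norms of the inverse steps: multiplicative, hence convenient for the
          induction, and an upper bound for the norm of the inverse block.\<close>
        define G where "G a c = (\<Prod>s=a..<c. N (Suc s) s)" for a c
        have Gpos: "G a c > 0" for a c unfolding G_def using pos by (intro prod_pos) auto
        have G: "N (a + t) a \<le> G a (a + t)" for a t
        proof (induction t)
          case (Suc t)
          have "N (a + Suc t) a \<le> N (a + Suc t) (a + t) * N (a + t) a" by (rule sub)
          also have "\<dots> \<le> N (a + Suc t) (a + t) * G a (a + t)"
            using pos Suc.IH by (intro mult_left_mono) (auto simp: less_imp_le)
          finally show ?case by (simp add: G_def mult.commute)
        qed (simp add: G_def diag)
        have decay: "N a (a + 2 ^ t) * G a (a + 2 ^ t) \<le> (Y * r ^ t) ^ (2 ^ t) / (3 * M)"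
          if "j \<le> a" "a + 2 ^ t \<le> j + h" for a t
          using that
        proof (induction t arbitrary: a)
          case 0
          have "G a (Suc a) = N (Suc a) a" by (simp add: G_def)
          then show ?case using step1[of a] M by (simp add: Y_def)
        next
          case (Suc t)
          define s :: nat where "s = 2 ^ t"
          define Z where "Z = (Y * r ^ t) ^ s / (3 * M)"
          have Z: "Z \<ge> 0" using Y r M by (auto simp: Z_def)
          have s: "2 ^ Suc t = 2 * s" by (simp add: s_def)
          have a: "j \<le> a" "a + 2 * s \<le> j + h" using Suc.prems by (auto simp: s_def)
          have IH1: "N a (a + s) * G a (a + s) \<le> Z"
            using Suc.IH[of a] a by (simp add: s_def Z_def)
          have IH2: "N (a + s) (a + 2 * s) * G (a + s) (a + 2 * s) \<le> Z"
            using Suc.IH[of "a + s"] a by (simp add: s_def Z_def mult_2 add.assoc)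
          have "G a (a + 2 * s) = G a (a + s) * G (a + s) (a + 2 * s)"
            unfolding G_def by (rule prod.atLeastLessThan_concat[symmetric]) auto
          moreover have "N a (a + 2 * s) = q a (a + s) (a + 2 * s) * (N a (a + s) * N (a + s) (a + 2 * s))"
            using nz by (simp add: q_def)
          ultimately have "N a (a + 2 * s) * G a (a + 2 * s) = q a (a + s) (a + 2 * s) *
              ((N a (a + s) * G a (a + s)) * (N (a + s) (a + 2 * s) * G (a + s) (a + 2 * s)))"
            by simp
          also have "\<dots> \<le> (3 * M * \<rho> ^ s) * (Z * Z)"
            using pos Gpos M \<rho> Z by (intro mult_mono middle IH1 IH2 a) (auto simp: less_imp_le)
          also have "\<dots> = (Y * r ^ Suc t) ^ (2 * s) / (3 * M)"
            using M by (simp add: Z_def power_mult_distrib power_mult r(3) power2_eq_square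
                field_simps flip: r(3))
          finally show ?case unfolding s .
        qed
        have "1 \<le> N j (j + h) * N (j + h) j" by (rule one)
        also have "\<dots> \<le> N j (j + h) * G j (j + h)"
          using pos G by (intro mult_left_mono) (auto simp: less_imp_le)
        also have "\<dots> \<le> (Y * r ^ n) ^ h / (3 * M)"
          using decay[of j n] by (simp add: h_def)
        also have "\<dots> \<le> 1 / (3 * M)"
          using n Y r M by (intro divide_right_mono power_le_one) auto
        also have "\<dots> < 1" using M by simp
        finally show False by simp
      qed
    qed
  qed
qed

section \<open>Matrices representing elements of the projective linear group\<close>

lemma PGL_coset:
  assumes "\<gamma> \<in> carrier PGL"
  obtains f :: "'a::euclidean_space \<Rightarrow> 'a" where "linear f" "bij f" "\<gamma> = {(\<lambda>x. c *\<^sub>R f x) | c. c \<noteq> 0}"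
proof -
  obtain f :: "'a \<Rightarrow> 'a" where f: "f \<in> carrier GL" "\<gamma> = homotheties #>\<^bsub>GL\<^esub> f"
    using assms unfolding PGL_def FactGroup_def RCOSETS_def by auto
  have "\<gamma> = {(\<lambda>x. c *\<^sub>R f x) | c. c \<noteq> 0}"
    unfolding f(2) r_coset_def homotheties_def by (auto simp: GL_def o_def)
  then show ?thesis using f(1) by (intro that) (auto simp: GL_def)
qed

lemma PGL_elements:
  fixes \<gamma> :: "('a::euclidean_space \<Rightarrow> 'a) set"
  assumes "\<gamma> \<in> carrier PGL"
  shows representative_in: "representative \<gamma> \<in> \<gamma>"
    and PGL_linear: "f \<in> \<gamma> \<Longrightarrow> linear f"
    and PGL_bij: "f \<in> \<gamma> \<Longrightarrow> bij f"
    and PGL_proportional: "f \<in> \<gamma> \<Longrightarrow> g \<in> \<gamma> \<Longrightarrow> \<exists>c. c \<noteq> 0 \<and> g = (\<lambda>x. c *\<^sub>R f x)"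
proof -
  obtain f0 :: "'a \<Rightarrow> 'a" where f0: "linear f0" "bij f0" "\<gamma> = {(\<lambda>x. c *\<^sub>R f0 x) | c. c \<noteq> 0}"
    using PGL_coset[OF assms] .
  have "(\<lambda>x. 1 *\<^sub>R f0 x) \<in> \<gamma>" unfolding f0(3) by (rule CollectI, intro exI[of _ 1]) simp
  then show "representative \<gamma> \<in> \<gamma>" unfolding representative_def using someI_ex[of "\<lambda>f. f \<in> \<gamma>"] by blast
  show "linear f" if "f \<in> \<gamma>" using that f0 by (auto intro: linear_compose_scale_right)
  show "bij f" if fin: "f \<in> \<gamma>"
  proof -
    obtain c where c: "f = (\<lambda>x. c *\<^sub>R f0 x)" "c \<noteq> 0" using fin f0 by auto
    have "bij ((*\<^sub>R) c :: 'a \<Rightarrow> 'a)"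
      using c by (intro o_bij[of "(*\<^sub>R) (inverse c)"]) auto
    then show ?thesis using bij_comp[OF f0(2)] by (simp add: c o_def)
  qed
  show "\<exists>c. c \<noteq> 0 \<and> g = (\<lambda>x. c *\<^sub>R f x)" if fg: "f \<in> \<gamma>" "g \<in> \<gamma>"
  proof -
    obtain c where "f = (\<lambda>x. c *\<^sub>R f0 x)" "c \<noteq> 0" using fg(1) f0(3) by auto
    moreover obtain d where "g = (\<lambda>x. d *\<^sub>R f0 x)" "d \<noteq> 0" using fg(2) f0(3) by auto
    ultimately show ?thesis by (intro exI[of _ "d / c"]) auto
  qed
qed

lemma PGL_mult_in:
  assumes "f \<in> \<gamma>" "g \<in> \<delta>"
  shows "f \<circ> g \<in> \<gamma> \<otimes>\<^bsub>PGL\<^esub> \<delta>"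
  using assms by (auto simp: PGL_def FactGroup_def set_mult_def GL_def)

lemma id_in_PGL_one: "id \<in> \<one>\<^bsub>PGL\<^esub>"
  by (auto simp: PGL_def FactGroup_def homotheties_def fun_eq_iff intro: exI[of _ 1])

text \<open>The matrices \<open>f\<^sup>-\<^sup>1 g\<close> compose on the nose along a sequence, which chosen representatives of the
  elements \<open>\<gamma>\<^sup>-\<^sup>1 \<delta>\<close> do only up to scalars.\<close>

lemma PGL_inv_mult_in:
  fixes \<gamma> \<delta> :: "('a::euclidean_space \<Rightarrow> 'a) set"
  assumes "\<gamma> \<in> carrier PGL" "\<delta> \<in> carrier PGL" "f \<in> \<gamma>" "g \<in> \<delta>"
  shows "inv_into UNIV f \<circ> g \<in> inv\<^bsub>PGL\<^esub> \<gamma> \<otimes>\<^bsub>PGL\<^esub> \<delta>"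
proof -
  interpret group "PGL :: ('a \<Rightarrow> 'a) set monoid" by (rule group_PGL)
  define h where "h = representative (inv\<^bsub>PGL\<^esub> \<gamma>)"
  have inv: "inv\<^bsub>PGL\<^esub> \<gamma> \<in> carrier PGL" using assms by simp
  have h: "h \<in> inv\<^bsub>PGL\<^esub> \<gamma>" unfolding h_def by (rule representative_in[OF inv])
  have "f \<circ> h \<in> \<one>\<^bsub>PGL\<^esub>" using PGL_mult_in[OF assms(3) h] assms by simp
  then obtain c where c: "c \<noteq> 0" "f \<circ> h = (\<lambda>x. c *\<^sub>R id x)"
    using PGL_proportional[OF one_closed id_in_PGL_one] by blast
  have f: "linear f" "bij f" using PGL_linear PGL_bij assms by blast+
  have "inv_into UNIV f x = (1 / c) *\<^sub>R h x" for x
  proof -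
    have "f ((1 / c) *\<^sub>R h x) = x"
      using fun_cong[OF c(2), of x] c(1) by (simp add: linear_scale[OF f(1)])
    then show ?thesis using f(2) by (metis bij_is_inj inv_f_f)
  qed
  then have "inv_into UNIV f = (\<lambda>x. (1 / c) *\<^sub>R h x)" by blast
  also have "\<dots> \<in> inv\<^bsub>PGL\<^esub> \<gamma>"
  proof -
    obtain f0 :: "'a \<Rightarrow> 'a" where f0: "inv\<^bsub>PGL\<^esub> \<gamma> = {(\<lambda>x. c *\<^sub>R f0 x) | c. c \<noteq> 0}"
      using PGL_coset[OF inv] by blast
    then obtain d where "h = (\<lambda>x. d *\<^sub>R f0 x)" "d \<noteq> 0" using h by auto
    then show ?thesis unfolding f0 using c(1) by (intro CollectI exI[of _ "d / c"]) auto
  qed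
  finally show ?thesis using assms(4) by (rule PGL_mult_in)
qed

lemma onorm_scaleR_linear:
  fixes f :: "'a::euclidean_space \<Rightarrow> 'b::euclidean_space"
  shows "linear f \<Longrightarrow> onorm (\<lambda>x. c *\<^sub>R f x) = \<bar>c\<bar> * onorm f"
  by (rule onorm_scaleR) (rule bounded_linear_of_linear)

lemma onorm_bij_pos:
  fixes f :: "'a::euclidean_space \<Rightarrow> 'a"
  assumes "linear f" "bij f"
  shows "onorm f > 0"
proof -
  obtain b :: 'a where "b \<in> Basis" using nonempty_Basis by blast
  then have "f b \<noteq> f 0" using bij_is_inj[OF assms(2)] by (auto dest!: injD)
  then show ?thesis
    using onorm_pos_lt[OF bounded_linear_of_linear[OF assms(1)]] linear_0[OF assms(1)] by auto
qed

definition condition_number :: "('a::euclidean_space \<Rightarrow> 'a) \<Rightarrow> real" where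
  "condition_number f = onorm f * onorm (inv_into UNIV f)"

lemma condition_number_scaleR:
  fixes f :: "'a::euclidean_space \<Rightarrow> 'a"
  assumes "linear f" "bij f" "c \<noteq> 0"
  shows "condition_number (\<lambda>x. c *\<^sub>R f x) = condition_number f"
proof -
  have "inv_into UNIV (\<lambda>x. c *\<^sub>R f x) = (\<lambda>x. (1 / c) *\<^sub>R inv_into UNIV f x)"
  proof (rule inv_equality)
    have lin: "linear (inv_into UNIV f)" using assms by (intro linear_inv_of_bij)
    show "(1 / c) *\<^sub>R inv_into UNIV f (c *\<^sub>R f x) = x" for x
      using assms by (simp add: linear_scale[OF lin] bij_is_inj)
    show "c *\<^sub>R f ((1 / c) *\<^sub>R inv_into UNIV f y) = y" for y
      using assms by (simp add: linear_scale bij_is_surj surj_f_inv_f)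
  qed
  then show ?thesis
    using assms by (simp add: condition_number_def onorm_scaleR_linear linear_inv_of_bij)
qed

text \<open>Singular values are available for representatives, whereas the middle factor \<open>B\<close> is in general
  another matrix in the same class. All terms are homogeneous in \<open>B\<close> once the second singular value
  is divided by the first.\<close>

lemma onorm_three_factors_proportional:
  fixes A B C B0 :: "'a::euclidean_space \<Rightarrow> 'a"
  assumes lin: "linear A" "linear B0" "linear C" and d: "DIM('a) \<ge> 2" and B: "B = (\<lambda>x. k *\<^sub>R B0 x)"
    and B0: "onorm B0 > 0"
  shows "onorm (A \<circ> B) * onorm (B \<circ> C) \<le> onorm (A \<circ> B \<circ> C) * onorm B
     + 4 * (singular_value 2 B0 / singular_value 1 B0) * (onorm A * (onorm B)\<^sup>2 * onorm C)"
proof -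
  define \<kappa> q where "\<kappa> = \<bar>k\<bar>" and "q = singular_value 2 B0 / singular_value 1 B0"
  have AB: "onorm (A \<circ> B) = \<kappa> * onorm (A \<circ> B0)"
    using onorm_scaleR_linear[OF linear_compose[OF lin(2,1)], of k]
    by (simp add: B o_def linear_scale[OF lin(1)] \<kappa>_def)
  have BC: "onorm (B \<circ> C) = \<kappa> * onorm (B0 \<circ> C)"
    using onorm_scaleR_linear[OF linear_compose[OF lin(3,2)], of k] by (simp add: B o_def \<kappa>_def)
  have ABC: "onorm (A \<circ> B \<circ> C) = \<kappa> * onorm (A \<circ> B0 \<circ> C)"
    using onorm_scaleR_linear[OF linear_compose[OF lin(3) linear_compose[OF lin(2,1)]], of k]
    by (simp add: B o_def linear_scale[OF lin(1)] \<kappa>_def)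
  have B': "onorm B = \<kappa> * onorm B0"
    using onorm_scaleR_linear[OF lin(2), of k] by (simp add: B \<kappa>_def)
  have q: "singular_value 2 B0 = q * onorm B0"
    using B0 by (simp add: q_def singular_value_1[OF lin(2)] del: One_nat_def)
  have "\<kappa>\<^sup>2 * (onorm (A \<circ> B0) * onorm (B0 \<circ> C)) \<le> \<kappa>\<^sup>2 * (onorm (A \<circ> B0 \<circ> C) * onorm B0
      + 4 * (onorm A * onorm B0 * onorm C * singular_value 2 B0))"
    using onorm_three_factors[OF lin d] by (intro mult_left_mono) auto
  from this[unfolded q] show ?thesis
    unfolding AB BC ABC B' q_def[symmetric] by (simp add: power2_eq_square algebra_simps)
qed

lemma major_axis_eq:
  fixes \<gamma> :: "('a::euclidean_space \<Rightarrow> 'a) set"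
  assumes "\<gamma> \<in> carrier PGL"
  obtains v where "norm v = 1" "norm (representative \<gamma> v) = onorm (representative \<gamma>)"
    "major_axis \<gamma> = proj_line (representative \<gamma> v)"
proof -
  define f where "f = representative \<gamma>"
  have lin: "linear f" using assms PGL_linear representative_in unfolding f_def by blast
  note bl = bounded_linear_of_linear[OF lin]
  obtain v0 where v0: "norm v0 = 1" "norm (f v0) = onorm f" using top_direction_exists[OF lin] .
  have le: "norm (f u) \<le> onorm f" if "norm u = 1" for u using onorm[OF bl, of u] that by simp
  define w where "w = (SOME w. w \<in> f ` sphere 0 1 \<and> (\<forall>u\<in>f ` sphere 0 1. norm u \<le> norm w))"
  have "w \<in> f ` sphere 0 1 \<and> (\<forall>u\<in>f ` sphere 0 1. norm u \<le> norm w)"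
    unfolding w_def by (rule someI[of _ "f v0"]) (use v0 le in auto)
  moreover have "f v0 \<in> f ` sphere 0 1" using v0 by simp
  ultimately have w: "w \<in> f ` sphere 0 1" "norm (f v0) \<le> norm w" by blast+
  then obtain v where v: "norm v = 1" "w = f v" by auto
  have "norm (f v) = onorm f" using v v0 w(2) le[OF v(1)] by simp
  moreover have "major_axis \<gamma> = proj_line (f v)"
    unfolding major_axis_def Let_def f_def[symmetric] w_def[symmetric] v(2) ..
  ultimately show ?thesis using v(1) that unfolding f_def by blast
qed

lemma dist_major_axis:
  fixes \<gamma> \<delta> :: "('a::euclidean_space \<Rightarrow> 'a) set"
  assumes \<gamma>: "\<gamma> \<in> carrier PGL" and \<delta>: "\<delta> \<in> carrier PGL" and d: "DIM('a) \<ge> 2"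
  shows "dist (major_axis \<gamma>) (major_axis (\<gamma> \<otimes>\<^bsub>PGL\<^esub> \<delta>))
     \<le> condition_number (representative \<delta>) * sv_ratio 2 1 \<gamma>"
proof -
  interpret group "PGL :: ('a \<Rightarrow> 'a) set monoid" by (rule group_PGL)
  define A H P where "A = representative \<gamma>" and "H = representative \<delta>"
    and "P = representative (\<gamma> \<otimes>\<^bsub>PGL\<^esub> \<delta>)"
  have \<gamma>\<delta>: "\<gamma> \<otimes>\<^bsub>PGL\<^esub> \<delta> \<in> carrier PGL" using \<gamma> \<delta> by simp
  have A: "linear A" "bij A" and H: "linear H" "bij H" and P: "linear P" "bij P"
    using PGL_linear PGL_bij representative_in \<gamma> \<delta> \<gamma>\<delta> unfolding A_def H_def P_def by blast+
  have "A \<circ> H \<in> \<gamma> \<otimes>\<^bsub>PGL\<^esub> \<delta>"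
    unfolding A_def H_def by (intro PGL_mult_in representative_in \<gamma> \<delta>)
  then obtain c where c: "c \<noteq> 0" "P = (\<lambda>x. c *\<^sub>R (A \<circ> H) x)"
    using PGL_proportional[OF \<gamma>\<delta> _ representative_in[OF \<gamma>\<delta>]] unfolding P_def by blast
  obtain v where v: "norm v = 1" "norm (A v) = onorm A" "major_axis \<gamma> = proj_line (A v)"
    using major_axis_eq[OF \<gamma>] unfolding A_def .
  obtain x where x: "norm x = 1" "norm (P x) = onorm P" "major_axis (\<gamma> \<otimes>\<^bsub>PGL\<^esub> \<delta>) = proj_line (P x)"
    using major_axis_eq[OF \<gamma>\<delta>] unfolding P_def .
  have "onorm P = \<bar>c\<bar> * onorm (A \<circ> H)"
    unfolding c(2) by (rule onorm_scaleR_linear) (rule linear_compose[OF H(1) A(1)])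
  then have AHx: "norm (A (H x)) = onorm (A \<circ> H)" using x(2) c by simp
  have "proj_line (P x) = proj_line (A (H x))"
    unfolding proj_line_def by (simp add: c(2) span_scaled_singleton[OF c(1)])
  then have "dist (major_axis \<gamma>) (major_axis (\<gamma> \<otimes>\<^bsub>PGL\<^esub> \<delta>)) = dist (proj_line (A v)) (proj_line (A (H x)))"
    using v x by simp
  also have "\<dots> \<le> onorm H * onorm (inv_into UNIV H) * (singular_value 2 A / onorm A)"
    using H bij_is_surj[OF H(2)]
    by (intro dist_top_axes A H linear_inv_of_bij onorm_bij_pos d v x AHx) (auto simp: surj_iff)
  finally show ?thesis
    by (simp add: condition_number_def sv_ratio_def A_def H_def
        singular_value_1[OF A(1), unfolded A_def] del: One_nat_def)
qed

text \<open>Projective space is complete, being the image of the compact unit sphere.\<close>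

lemma Cauchy_proj_convergent:
  fixes X :: "nat \<Rightarrow> 'a::euclidean_space proj"
  assumes "Cauchy X"
  obtains L where "X \<longlonglongrightarrow> L"
proof -
  define w where "w n = sgn (proj_vec (X n))" for n
  have w: "norm (w n) = 1" "proj_line (w n) = X n" for n
  proof -
    show "norm (w n) = 1" by (simp add: w_def norm_sgn proj_vec)
    have "span {w n} = span {proj_vec (X n)}"
      unfolding w_def sgn_div_norm by (rule span_scaled_singleton) (simp add: proj_vec)
    then show "proj_line (w n) = X n" unfolding proj_line_def by (metis proj_line_def proj_vec(2))
  qed
  have "seq_compact (sphere (0::'a) 1)" by (intro compact_imp_seq_compact compact_sphere)
  moreover have "\<forall>n. w n \<in> sphere 0 1" using w(1) by simp
  ultimately obtain z s where z: "z \<in> sphere 0 1" "strict_mono (s :: nat \<Rightarrow> nat)" "(w \<circ> s) \<longlonglongrightarrow> z"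
    by (rule seq_compactE)
  have "norm (dist (X (s n)) (proj_line z)) \<le> norm (w (s n) - z)" for n
  proof -
    have "z \<noteq> 0" "w (s n) \<noteq> 0" using z(1) w(1)[of "s n"] by auto
    then show ?thesis
      using dist_proj_line_le[of z "w (s n)" 1] w unfolding dist_commute[of "X (s n)"] by simp
  qed
  moreover have "(\<lambda>n. norm (w (s n) - z)) \<longlonglongrightarrow> 0"
    using z(3) by (intro tendsto_norm_zero LIM_zero) (simp add: o_def)
  ultimately have "(\<lambda>n. dist (X (s n)) (proj_line z)) \<longlonglongrightarrow> 0"
    by (intro Lim_null_comparison[of "\<lambda>n. dist (X (s n)) (proj_line z)" "\<lambda>n. norm (w (s n) - z)"]
        always_eventually allI)
  then have "(X \<circ> s) \<longlonglongrightarrow> proj_line z" unfolding o_def by (rule tendsto_dist_iff[THEN iffD2])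
  then have "X \<longlonglongrightarrow> proj_line z"
    using Cauchy_converges_subseq[OF assms z(2)] by blast
  then show ?thesis by (rule that)
qed

section \<open>Coverings of ellipsoids in projective space\<close>

lemma real_floor_eq_imp_close:
  assumes "\<lfloor>x / c\<rfloor> = \<lfloor>y / c\<rfloor>" "(c::real) > 0"
  shows "\<bar>x - y\<bar> \<le> c"
proof -
  have "\<bar>x / c - y / c\<bar> \<le> 1" using assms(1) by linarith
  then have "\<bar>x - y\<bar> / c \<le> 1" using assms(2) by (simp add: diff_divide_distrib[symmetric])
  then show ?thesis using assms(2) by (simp add: field_simps)
qed

lemma diameter_le_of_dist:
  fixes X :: "'b::metric_space set"
  assumes "\<And>x y. x \<in> X \<Longrightarrow> y \<in> X \<Longrightarrow> dist x y \<le> e" "0 \<le> e"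
  shows "bounded X \<and> diameter X \<le> e"
proof
  show "bounded X" unfolding bounded_two_points using assms(1) by blast
  show "diameter X \<le> e" using assms unfolding diameter_def by (auto intro!: cSUP_least)
qed

text \<open>The points \<open>z\<close> of the unit sphere with \<open>norm (A\<^sup>-\<^sup>1 z) \<le> 1 / (\<epsilon> onorm A)\<close> fill an ellipsoid whose
  coordinates \<open>c i\<close> along the axes \<open>u i\<close> of \<open>A\<close> satisfy \<open>\<bar>c i\<bar> \<le> r i / \<epsilon>\<close>. The gap hypothesis makes
  \<open>c 2, \<dots>\<close> so small that \<open>\<bar>c 1\<bar> \<ge> 1/2\<close>, so in the affine chart \<open>t i = c i / c 1\<close> the lines
  through such \<open>z\<close> lie in the box \<open>\<bar>t i\<bar> \<le> 2 r i / \<epsilon>\<close> for \<open>i = 2, \<dots>, d\<close>. This box is cut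
  into cubes of side \<open>r (p + 1)\<close>: a side with \<open>i \<le> p\<close> needs about \<open>r i / r (p + 1)\<close> pieces and a side
  with \<open>i > p\<close> boundedly many. Distances in projective space are
  bounded by the sum of the differences of the coordinates \<open>t i\<close>.\<close>

lemma ellipsoid_cover:
  fixes A :: "'a::euclidean_space \<Rightarrow> 'a"
  assumes lin: "linear A" and bij: "bij A" and d: "DIM('a) \<ge> 2" and p: "p \<in> {1..DIM('a) - 1}"
    and \<epsilon>: "\<epsilon> > 0"
  defines "r \<equiv> \<lambda>i. singular_value i A / singular_value 1 A"
  assumes gap: "real DIM('a) * (r 2)\<^sup>2 \<le> 3 / 4 * \<epsilon>\<^sup>2"
  shows "r (p + 1) > 0"
    and "\<exists>F. finite F \<and> (\<forall>z. norm z = 1 \<longrightarrow> \<epsilon> * onorm A * norm (inv_into UNIV A z) \<le> 1 \<longrightarrow> proj_line z \<in> \<Union>F) \<and>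
       (\<forall>U\<in>F. bounded U \<and> diameter U \<le> real DIM('a) * r (p + 1)) \<and>
       real (card F) \<le> (4 / \<epsilon> + 1) ^ (DIM('a) - 1) * (\<Prod>i=2..p. r i / r (p + 1))"
proof -
  let ?d = "DIM('a)"
  define s where "s i = singular_value i A" for i
  obtain v where v: "singular_basis A v" using singular_value_decomposition(1)[OF lin] by blast
  note vin = singular_basis_inner[OF v]
  have spos: "s i > 0" if i: "i \<in> {1..?d}" for i
  proof -
    have "v i \<noteq> 0" using vin(1)[OF i i] by auto
    then have "A (v i) \<noteq> A 0" using bij by (auto dest!: bij_is_inj injD)
    then have "A (v i) \<bullet> A (v i) \<noteq> 0" by (simp add: linear_0[OF lin])
    then have "s i \<noteq> 0" using vin(2)[OF i i] by (auto simp: s_def)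
    then show ?thesis using singular_value_nonneg[OF lin i] by (auto simp: s_def order_less_le)
  qed
  have one: "1 \<in> {1..?d}" and pd: "p + 1 \<in> {1..?d}" "p + 1 \<le> ?d" using d p by auto
  have s1: "s 1 = onorm A" unfolding s_def by (rule singular_value_1[OF lin])
  have r: "r i = s i / s 1" for i by (simp add: r_def s_def)
  have rpos: "r i > 0" if "i \<in> {1..?d}" for i using spos[OF that] spos[OF one] by (simp add: r)
  have rmono: "r j \<le> r i" if "1 \<le> i" "i \<le> j" "j \<le> ?d" for i j
    using singular_value_antimono[OF lin that] spos[OF one] by (simp add: r s_def divide_right_mono)
  define \<rho> where "\<rho> = r (p + 1)"
  show rp: "r (p + 1) > 0" using rpos pd by blast
  then have \<rho>: "\<rho> > 0" by (simp add: \<rho>_def)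
  define u where "u i = (1 / s i) *\<^sub>R A (v i)" for i
  have uu: "u i \<bullet> u j = (if i = j then 1 else 0)" if "i \<in> {1..?d}" "j \<in> {1..?d}" for i j
    using vin(2)[OF that] spos[OF that(1)] spos[OF that(2)] by (simp add: u_def s_def power2_eq_square)
  define pt where "pt t = u 1 + (\<Sum>i=2..?d. t i *\<^sub>R u i)" for t :: "nat \<Rightarrow> real"
  have pt1: "u 1 \<bullet> pt t = 1" for t
  proof -
    have "(\<Sum>i=2..?d. t i * (u 1 \<bullet> u i)) = 0"
      using one by (intro sum.neutral) (auto simp: uu)
    then show ?thesis using uu[OF one one] by (simp add: pt_def inner_add_right inner_sum_right)
  qed
  have nu: "norm (u i) = 1" if "i \<in> {1..?d}" for i using uu[OF that that] by (simp add: norm_eq_sqrt_inner)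
  have npt: "norm (pt t) \<ge> 1" for t
    using Cauchy_Schwarz_ineq2[of "u 1" "pt t"] pt1[of t] nu[OF one] by simp
  then have pt0: "pt t \<noteq> 0" for t by (metis norm_zero not_one_le_zero)
  have dist_pt: "dist (proj_line (pt t)) (proj_line (pt t')) \<le> (\<Sum>i=2..?d. \<bar>t' i - t i\<bar>)" for t t'
  proof -
    have "dist (proj_line (pt t)) (proj_line (pt t')) \<le> norm (pt t' - 1 *\<^sub>R pt t) / norm (pt t')"
      by (intro dist_proj_line_le pt0)
    also have "\<dots> \<le> norm (pt t' - 1 *\<^sub>R pt t) / 1" using npt[of t'] by (intro divide_left_mono) auto
    also have "pt t' - 1 *\<^sub>R pt t = (\<Sum>i=2..?d. (t' i - t i) *\<^sub>R u i)"
      by (simp add: pt_def sum_subtractf scaleR_diff_left)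
    also have "norm \<dots> / 1 \<le> (\<Sum>i=2..?d. \<bar>t' i - t i\<bar>)"
      by simp (rule sum_norm_le, use nu in auto)
    finally show ?thesis .
  qed
  \<comment> \<open>Cells of the grid of mesh \<open>\<rho>\<close> on the box \<open>\<bar>t i\<bar> \<le> L i\<close>; \<open>k\<close> is the multi-index of a cell.\<close>
  define L where "L i = 2 * r i / \<epsilon>" for i
  define m where "m i = nat \<lfloor>2 * L i / \<rho>\<rfloor>" for i
  define cell where "cell k = {proj_line (pt t) | t. \<forall>i\<in>{2..?d}. \<lfloor>(t i + L i) / \<rho>\<rfloor> = int (k i)}" for k :: "nat \<Rightarrow> nat"
  define I where "I = Pi\<^sub>E {2..?d} (\<lambda>i. {0..m i})"
  have finI: "finite I" unfolding I_def by (intro finite_PiE) auto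
  have cover: "proj_line z \<in> \<Union> (cell ` I)"
    if z: "norm z = 1" "\<epsilon> * onorm A * norm (inv_into UNIV A z) \<le> 1" for z
  proof -
    define x where "x = inv_into UNIV A z"
    have Ax: "A x = z" unfolding x_def using bij by (simp add: bij_is_surj surj_f_inv_f)
    define c where "c i = s i * (v i \<bullet> x)" for i
    have cb: "\<bar>c i\<bar> \<le> r i / \<epsilon>" if i: "i \<in> {1..?d}" for i
    proof -
      have "norm (v i) = 1" using vin(1)[OF i i] by (simp add: norm_eq_sqrt_inner)
      then have "\<bar>v i \<bullet> x\<bar> \<le> norm x" using Cauchy_Schwarz_ineq2[of "v i" x] by simp
      also have "\<dots> \<le> 1 / (\<epsilon> * s 1)"
        using z(2) \<epsilon> spos[OF one] unfolding x_def[symmetric] s1[symmetric] by (simp add: field_simps)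
      finally have "s i * \<bar>v i \<bullet> x\<bar> \<le> s i * (1 / (\<epsilon> * s 1))"
        using spos[OF i] by (intro mult_left_mono) auto
      then show ?thesis using spos[OF i] by (simp add: c_def abs_mult r mult.commute)
    qed
    have zexp: "z = (\<Sum>i=1..?d. c i *\<^sub>R u i)"
    proof -
      have "x = (\<Sum>i=1..?d. (v i \<bullet> x) *\<^sub>R v i)" using v unfolding singular_basis_def by blast
      then have "z = (\<Sum>i=1..?d. (v i \<bullet> x) *\<^sub>R A (v i))"
        by (metis (no_types, lifting) Ax linear_sum[OF lin] linear_scale[OF lin] sum.cong)
      also have "\<dots> = (\<Sum>i=1..?d. c i *\<^sub>R u i)"
      proof (rule sum.cong[OF refl])
        fix i assume "i \<in> {1..?d}"
        then show "(v i \<bullet> x) *\<^sub>R A (v i) = c i *\<^sub>R u i" using spos[of i] by (simp add: c_def u_def)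
      qed
      finally show ?thesis .
    qed
    have split: "{1..?d} = insert 1 {2..?d}" using d by auto
    have "1 = (\<Sum>i=1..?d. (c i)\<^sup>2)"
    proof -
      have "1 = A x \<bullet> A x" using z by (simp add: Ax dot_square_norm)
      also have "\<dots> = (\<Sum>i=1..?d. (c i)\<^sup>2)"
        unfolding singular_basis_expansion(2)[OF lin v] c_def s_def
        by (simp add: power_mult_distrib power2_eq_square mult_ac)
      finally show ?thesis .
    qed
    also have "\<dots> = (c 1)\<^sup>2 + (\<Sum>i=2..?d. (c i)\<^sup>2)" unfolding split by simp
    also have "(\<Sum>i=2..?d. (c i)\<^sup>2) \<le> (\<Sum>i=2..?d. (r 2 / \<epsilon>)\<^sup>2)"
    proof (rule sum_mono)
      fix i assume i: "i \<in> {2..?d}"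
      then have "\<bar>c i\<bar> \<le> r i / \<epsilon>" by (intro cb) auto
      also have "\<dots> \<le> r 2 / \<epsilon>" using i \<epsilon> by (intro divide_right_mono rmono) auto
      finally have "\<bar>c i\<bar>\<^sup>2 \<le> (r 2 / \<epsilon>)\<^sup>2" by (intro power_mono) auto
      then show "(c i)\<^sup>2 \<le> (r 2 / \<epsilon>)\<^sup>2" by simp
    qed
    also have "\<dots> \<le> real ?d * (r 2 / \<epsilon>)\<^sup>2" by (simp add: mult_right_mono)
    also have "\<dots> \<le> 3 / 4" using gap \<epsilon> by (simp add: power_divide field_simps)
    finally have "(1 / 2)\<^sup>2 \<le> (c 1)\<^sup>2" by (simp add: power2_eq_square)
    then have c1: "\<bar>c 1\<bar> \<ge> 1 / 2" by (metis abs_le_square_iff abs_of_pos half_gt_zero zero_less_one)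
    then have c10: "c 1 \<noteq> 0" by auto
    define t where "t i = c i / c 1" for i
    have "z = c 1 *\<^sub>R pt t"
      using c10 unfolding zexp split pt_def t_def by (simp add: scaleR_add_right scaleR_sum_right)
    then have "proj_line z = proj_line (pt t)"
      using proj_line_scaleR[OF c10] by metis
    moreover have tb: "\<bar>t i\<bar> \<le> L i" if i: "i \<in> {2..?d}" for i
    proof -
      have "\<bar>c i\<bar> \<le> r i / \<epsilon>" "r i > 0" using i by (auto intro!: cb rpos)
      then have "\<bar>c i\<bar> / \<bar>c 1\<bar> \<le> (r i / \<epsilon>) / (1 / 2)" using c1 by (intro frac_le) auto
      then show ?thesis by (simp add: t_def L_def mult.commute)
    qed
    define k where "k = restrict (\<lambda>i. nat \<lfloor>(t i + L i) / \<rho>\<rfloor>) {2..?d}"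
    have fl: "0 \<le> \<lfloor>(t i + L i) / \<rho>\<rfloor>" "\<lfloor>(t i + L i) / \<rho>\<rfloor> \<le> \<lfloor>2 * L i / \<rho>\<rfloor>" if i: "i \<in> {2..?d}" for i
    proof -
      show "0 \<le> \<lfloor>(t i + L i) / \<rho>\<rfloor>" using tb[OF i] \<rho> by (simp add: abs_le_iff)
      show "\<lfloor>(t i + L i) / \<rho>\<rfloor> \<le> \<lfloor>2 * L i / \<rho>\<rfloor>" using tb[OF i] \<rho> by (intro floor_mono divide_right_mono) auto
    qed
    have "k \<in> I" unfolding I_def k_def by (auto simp: m_def intro!: nat_mono fl)
    moreover have "proj_line (pt t) \<in> cell k"
      unfolding cell_def k_def using fl by (intro CollectI exI[of _ t]) auto
    ultimately show ?thesis by auto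
  qed
  have small: "bounded (cell k) \<and> diameter (cell k) \<le> real ?d * r (p + 1)" for k
  proof (rule diameter_le_of_dist)
    fix x y assume "x \<in> cell k" "y \<in> cell k"
    then obtain t t' where x: "x = proj_line (pt t)" "\<forall>i\<in>{2..?d}. \<lfloor>(t i + L i) / \<rho>\<rfloor> = int (k i)"
      and y: "y = proj_line (pt t')" "\<forall>i\<in>{2..?d}. \<lfloor>(t' i + L i) / \<rho>\<rfloor> = int (k i)"
      unfolding cell_def by auto
    have "dist x y \<le> (\<Sum>i=2..?d. \<bar>t' i - t i\<bar>)" unfolding x y by (rule dist_pt)
    also have "\<dots> \<le> (\<Sum>i=2..?d. \<rho>)"
    proof (rule sum_mono)
      fix i assume "i \<in> {2..?d}"
      then show "\<bar>t' i - t i\<bar> \<le> \<rho>"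
        using real_floor_eq_imp_close[of "t' i + L i" \<rho> "t i + L i"] x y \<rho> by simp
    qed
    also have "\<dots> \<le> real ?d * \<rho>" using \<rho> by (simp add: mult_right_mono)
    finally show "dist x y \<le> real ?d * r (p + 1)" by (simp add: \<rho>_def)
  qed (use rp in simp)
  define Q where "Q = 4 / \<epsilon> + 1"
  have Q: "Q \<ge> 0" using \<epsilon> by (simp add: Q_def)
  have m: "real (m i + 1) \<le> 4 / \<epsilon> * (r i / \<rho>) + 1" if "i \<in> {2..?d}" for i
  proof -
    have "0 \<le> 2 * L i / \<rho>" using rpos[of i] that \<epsilon> \<rho> by (simp add: L_def)
    then have "real (m i) \<le> 2 * L i / \<rho>" unfolding m_def by (simp add: of_nat_floor)
    then show ?thesis by (simp add: L_def field_simps)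
  qed
  have "real (card (cell ` I)) \<le> real (card I)"
    using card_image_le[OF finI, of cell] by simp
  also have "\<dots> = (\<Prod>i=2..?d. real (m i + 1))"
    unfolding I_def by (subst card_PiE) auto
  also have "\<dots> \<le> (\<Prod>i=2..?d. Q * (if i \<le> p then r i / \<rho> else 1))"
  proof (rule prod_mono)
    fix i assume i: "i \<in> {2..?d}"
    show "0 \<le> real (m i + 1) \<and> real (m i + 1) \<le> Q * (if i \<le> p then r i / \<rho> else 1)"
    proof (cases "i \<le> p")
      case True
      then have "1 \<le> r i / \<rho>" using rmono[of i "p + 1"] i pd \<rho> by (simp add: \<rho>_def)
      then show ?thesis using m[OF i] True by (simp add: Q_def algebra_simps)
    next
      case False
      then have "r i / \<rho> \<le> 1" using rmono[of "p + 1" i] i pd \<rho> by (simp add: \<rho>_def)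
      then have "4 / \<epsilon> * (r i / \<rho>) \<le> 4 / \<epsilon> * 1" using \<epsilon> by (intro mult_left_mono) auto
      then show ?thesis using m[OF i] False by (simp add: Q_def)
    qed
  qed
  also have "\<dots> = Q ^ (?d - 1) * (\<Prod>i=2..?d. if i \<le> p then r i / \<rho> else 1)"
    by (simp add: prod.distrib numeral_2_eq_2)
  also have "(\<Prod>i=2..?d. if i \<le> p then r i / \<rho> else 1) = (\<Prod>i=2..p. r i / \<rho>)"
    using pd by (intro prod.mono_neutral_cong_right) auto
  finally have "real (card (cell ` I)) \<le> Q ^ (?d - 1) * (\<Prod>i=2..p. r i / r (p + 1))"
    by (simp add: \<rho>_def)
  then show "\<exists>F. finite F \<and> (\<forall>z. norm z = 1 \<longrightarrow> \<epsilon> * onorm A * norm (inv_into UNIV A z) \<le> 1 \<longrightarrow> proj_line z \<in> \<Union>F) \<and>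
       (\<forall>U\<in>F. bounded U \<and> diameter U \<le> real ?d * r (p + 1)) \<and>
       real (card F) \<le> (4 / \<epsilon> + 1) ^ (?d - 1) * (\<Prod>i=2..p. r i / r (p + 1))"
    using finI cover small unfolding Q_def by (intro exI[of _ "cell ` I"]) blast
qed

section \<open>Null sets for Hausdorff measure and tails of series\<close>

lemma hausdorff_measure_zeroI:
  fixes A :: "'b::metric_space set"
  assumes "\<And>e \<delta>. e > 0 \<Longrightarrow> \<delta> > 0 \<Longrightarrow> \<exists>F. finite F \<and> A \<subseteq> \<Union>F \<and>
     (\<forall>U\<in>F. bounded U \<and> diameter U \<le> \<delta>) \<and> (\<Sum>U\<in>F. diameter U powr s) \<le> e"
  shows "hausdorff_measure s A = 0"
proof -
  have "hausdorff_premeasure s \<delta> A \<le> ennreal e" if \<delta>: "\<delta> > 0" and e: "e > 0" for \<delta> e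
  proof -
    obtain F where F: "finite F" "A \<subseteq> \<Union>F" "\<forall>U\<in>F. bounded U \<and> diameter U \<le> \<delta>"
      "(\<Sum>U\<in>F. diameter U powr s) \<le> e"
      using assms[OF e \<delta>] by blast
    obtain f :: "nat \<Rightarrow> 'b set" where f: "bij_betw f {0..<card F} F"
      using ex_bij_betw_nat_finite[OF F(1)] by blast
    define U where "U n = (if n < card F then f n else {})" for n
    have fF: "f n \<in> F" if "n < card F" for n using f that by (auto dest: bij_betwE)
    have "A \<subseteq> (\<Union>n. U n)"
    proof
      fix x assume "x \<in> A"
      then obtain V where V: "V \<in> F" "x \<in> V" using F(2) by blast
      then have "V \<in> f ` {0..<card F}" unfolding bij_betw_imp_surj_on[OF f] by simp
      then obtain n where "n < card F" "V = f n" by auto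
      then have "x \<in> U n" using V by (simp add: U_def)
      then show "x \<in> (\<Union>n. U n)" by blast
    qed
    moreover have "bounded (U n) \<and> diameter (U n) \<le> \<delta>" for n
      using F(3) fF \<delta> by (auto simp: U_def)
    ultimately have "hausdorff_premeasure s \<delta> A \<le> (\<Sum>n. ennreal (diameter (U n) powr s))"
      unfolding hausdorff_premeasure_def by (intro INF_lower) auto
    also have "\<dots> = (\<Sum>n\<in>{0..<card F}. ennreal (diameter (U n) powr s))"
      by (rule suminf_finite) (auto simp: U_def)
    also have "\<dots> = (\<Sum>n\<in>{0..<card F}. ennreal (diameter (f n) powr s))"
      by (intro sum.cong) (auto simp: U_def)
    also have "\<dots> = (\<Sum>V\<in>F. ennreal (diameter V powr s))"
      by (rule sum.reindex_bij_betw[OF f])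
    also have "\<dots> = ennreal (\<Sum>V\<in>F. diameter V powr s)" by (rule sum_ennreal) simp
    also have "\<dots> \<le> ennreal e" using F(4) by (rule ennreal_leI)
    finally show ?thesis .
  qed
  then have "hausdorff_premeasure s \<delta> A = 0" if "\<delta> > 0" for \<delta>
    using that by (metis ennreal_le_epsilon add.left_neutral le_zero_eq)
  then show ?thesis unfolding hausdorff_measure_def by simp
qed

lemma sum_Union_le_sum:
  fixes f :: "'b \<Rightarrow> real"
  assumes "finite I" "\<And>i. i \<in> I \<Longrightarrow> finite (F i)" "\<And>x. f x \<ge> 0"
  shows "sum f (\<Union>i\<in>I. F i) \<le> (\<Sum>i\<in>I. sum f (F i))"
  using assms(1,2)
proof (induction I rule: finite_induct)
  case (insert i I)
  have "sum f (\<Union>j\<in>insert i I. F j) = sum f (F i \<union> (\<Union>j\<in>I. F j))" by simp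
  also have "\<dots> \<le> sum f (F i) + sum f (\<Union>j\<in>I. F j)"
    using insert.prems insert.hyps assms(3) by (subst sum_Un) (auto intro!: sum_nonneg)
  also have "\<dots> \<le> sum f (F i) + (\<Sum>j\<in>I. sum f (F j))" using insert by simp
  finally show ?case using insert.hyps by simp
qed simp

text \<open>The values \<open>sum f T\<close> over finite \<open>T \<subseteq> A\<close> are bounded; a set \<open>T\<close> which nearly attains their
  supremum leaves little for the sets disjoint from it.\<close>

lemma finite_infsum_tail:
  fixes f :: "'b \<Rightarrow> real"
  assumes nn: "\<And>x. x \<in> A \<Longrightarrow> f x \<ge> 0" and fin: "(\<Sum>\<^sub>\<infinity>x\<in>A. ennreal (f x)) < \<infinity>" and e: "e > 0"
  obtains T where "finite T" "T \<subseteq> A" "\<And>U. finite U \<Longrightarrow> U \<subseteq> A - T \<Longrightarrow> sum f U \<le> e"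
proof -
  let ?I = "\<Sum>\<^sub>\<infinity>x\<in>A. ennreal (f x)"
  let ?B = "sum f ` {T. finite T \<and> T \<subseteq> A}"
  have bound: "sum f T \<le> enn2real ?I" if "finite T" "T \<subseteq> A" for T
  proof -
    have "ennreal (sum f T) = (\<Sum>x\<in>T. ennreal (f x))"
      using that nn by (intro sum_ennreal[symmetric]) auto
    also have "\<dots> \<le> (SUP T\<in>{T. finite T \<and> T \<subseteq> A}. \<Sum>x\<in>T. ennreal (f x))"
      using that by (intro SUP_upper) auto
    also have "\<dots> = ?I" by (rule nonneg_infsum_complete[symmetric]) simp
    finally have "enn2real (ennreal (sum f T)) \<le> enn2real ?I"
      using fin by (intro enn2real_mono) (auto simp: less_top)
    moreover have "0 \<le> sum f T" using that nn by (intro sum_nonneg) auto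
    ultimately show ?thesis by simp
  qed
  have bdd: "bdd_above ?B" unfolding bdd_above_def using bound by blast
  have ne: "?B \<noteq> {}" by blast
  have "Sup ?B - e < Sup ?B" using e by simp
  then obtain y where "y \<in> ?B" "Sup ?B - e < y" by (rule less_cSupE[OF _ ne])
  then obtain T where T: "finite T" "T \<subseteq> A" "Sup ?B - e < sum f T" by auto
  show ?thesis
  proof (rule that[OF T(1,2)])
    fix U assume U: "finite U" "U \<subseteq> A - T"
    then have "sum f (T \<union> U) = sum f T + sum f U"
      using T by (intro sum.union_disjoint) auto
    moreover have "sum f (T \<union> U) \<in> ?B" using T U by auto
    then have "sum f (T \<union> U) \<le> Sup ?B" using bdd by (rule cSup_upper)
    ultimately show "sum f U \<le> e" using T(3) by simp
  qed
qed

section \<open>Geodesic rays in projective Anosov groups\<close>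

locale projective_anosov_group =
  fixes \<Gamma> S :: "('a::euclidean_space \<Rightarrow> 'a) set set"
  assumes dim: "DIM('a) \<ge> 2" and anosov: "projective_anosov \<Gamma> S"
begin

abbreviation G where "G \<equiv> subgroup_of_PGL \<Gamma>"
abbreviation len where "len \<equiv> word_length G S"

lemma subgroup: "subgroup \<Gamma> PGL" and finite_S: "finite S" and S: "S \<subseteq> \<Gamma>"
  and generate: "generate G S = \<Gamma>"
  using anosov by (auto simp: projective_anosov_def)

sublocale G: group G
  rewrites "carrier G = \<Gamma>"
  by (rule subgroup.subgroup_is_group[OF subgroup group_PGL]) simp

lemma in_PGL: "\<gamma> \<in> \<Gamma> \<Longrightarrow> \<gamma> \<in> carrier PGL"
  using subgroup.subset[OF subgroup] by blast

lemma inv_eq: "\<gamma> \<in> \<Gamma> \<Longrightarrow> inv\<^bsub>G\<^esub> \<gamma> = inv\<^bsub>PGL\<^esub> \<gamma>"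
  by (rule group.m_inv_consistent[OF group_PGL subgroup])

lemma foldr_closed: "set ws \<subseteq> \<Gamma> \<Longrightarrow> foldr (\<otimes>\<^bsub>G\<^esub>) ws \<one>\<^bsub>G\<^esub> \<in> \<Gamma>"
  by (induction ws) (auto intro: subgroup.m_closed[OF subgroup] subgroup.one_closed[OF subgroup])

lemma foldr_append:
  assumes "set us \<subseteq> \<Gamma>" "set vs \<subseteq> \<Gamma>"
  shows "foldr (\<otimes>\<^bsub>G\<^esub>) (us @ vs) \<one>\<^bsub>G\<^esub> = foldr (\<otimes>\<^bsub>G\<^esub>) us \<one>\<^bsub>G\<^esub> \<otimes>\<^bsub>G\<^esub> foldr (\<otimes>\<^bsub>G\<^esub>) vs \<one>\<^bsub>G\<^esub>"
  using assms(1)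
proof (induction us)
  case Nil
  then show ?case using foldr_closed[OF assms(2)] G.l_one by simp
next
  case (Cons a us)
  then show ?case
    using foldr_closed[OF assms(2)] foldr_closed[of us] G.m_assoc by simp
qed

lemma letters: "S \<union> m_inv G ` S \<subseteq> \<Gamma>"
  using S G.inv_closed by auto

lemma word_exists:
  assumes "\<gamma> \<in> \<Gamma>"
  shows "\<exists>ws. set ws \<subseteq> S \<union> m_inv G ` S \<and> foldr (\<otimes>\<^bsub>G\<^esub>) ws \<one>\<^bsub>G\<^esub> = \<gamma>"
proof -
  have "\<gamma> \<in> generate G S" using assms generate by simp
  then show ?thesis
  proof (induction rule: generate.induct)
    case one
    show ?case by (intro exI[of _ "[]"]) simp
  next
    case (incl h)
    then have "h \<in> \<Gamma>" using S by blast
    then show ?case using incl G.r_one by (intro exI[of _ "[h]"]) simp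
  next
    case (inv h)
    then have "inv\<^bsub>G\<^esub> h \<in> \<Gamma>" using S G.inv_closed by blast
    then show ?case using inv G.r_one by (intro exI[of _ "[inv\<^bsub>G\<^esub> h]"]) simp
  next
    case (eng g h)
    then obtain us vs where "set us \<subseteq> S \<union> m_inv G ` S" "foldr (\<otimes>\<^bsub>G\<^esub>) us \<one>\<^bsub>G\<^esub> = g"
      "set vs \<subseteq> S \<union> m_inv G ` S" "foldr (\<otimes>\<^bsub>G\<^esub>) vs \<one>\<^bsub>G\<^esub> = h" by blast
    moreover from this have "set us \<subseteq> \<Gamma>" "set vs \<subseteq> \<Gamma>" using letters by blast+
    ultimately show ?case
      using foldr_append[of us vs] by (intro exI[of _ "us @ vs"]) simp
  qed
qed

lemma shortest_word:
  assumes "\<gamma> \<in> \<Gamma>"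
  shows "\<exists>ws. length ws = len \<gamma> \<and> set ws \<subseteq> S \<union> m_inv G ` S \<and> foldr (\<otimes>\<^bsub>G\<^esub>) ws \<one>\<^bsub>G\<^esub> = \<gamma>"
  unfolding word_length_def by (rule LeastI_ex) (use word_exists[OF assms] in blast)

lemma finite_ball: "finite {\<gamma>\<in>\<Gamma>. len \<gamma> \<le> n}"
proof (rule finite_subset)
  show "{\<gamma>\<in>\<Gamma>. len \<gamma> \<le> n}
      \<subseteq> (\<lambda>ws. foldr (\<otimes>\<^bsub>G\<^esub>) ws \<one>\<^bsub>G\<^esub>) ` {ws. set ws \<subseteq> S \<union> m_inv G ` S \<and> length ws \<le> n}"
    using shortest_word by fastforce
  show "finite ((\<lambda>ws. foldr (\<otimes>\<^bsub>G\<^esub>) ws \<one>\<^bsub>G\<^esub>) ` {ws. set ws \<subseteq> S \<union> m_inv G ` S \<and> length ws \<le> n})"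
    using finite_S by (intro finite_imageI finite_lists_length_le) auto
qed

lemma ray:
  assumes "\<alpha> \<in> geodesic_rays G S"
  shows ray_in: "\<alpha> i \<in> \<Gamma>" and ray_0: "\<alpha> 0 = \<one>\<^bsub>PGL\<^esub>"
    and ray_step_length: "i \<le> j \<Longrightarrow> len (inv\<^bsub>G\<^esub> (\<alpha> i) \<otimes>\<^bsub>G\<^esub> \<alpha> j) = j - i"
    and ray_length: "len (\<alpha> i) = i"
proof -
  show "\<alpha> i \<in> \<Gamma>" for i using assms by (auto simp: geodesic_rays_def)
  then have "inv\<^bsub>G\<^esub> (\<alpha> 0) \<otimes>\<^bsub>G\<^esub> \<alpha> i = \<alpha> i" for i
    using assms G.l_one G.inv_one by (simp add: geodesic_rays_def)
  moreover show step: "i \<le> j \<Longrightarrow> len (inv\<^bsub>G\<^esub> (\<alpha> i) \<otimes>\<^bsub>G\<^esub> \<alpha> j) = j - i" for i j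
    using assms by (simp add: geodesic_rays_def word_dist_def)
  ultimately show "len (\<alpha> i) = i" using step[of 0 i] by simp
  show "\<alpha> 0 = \<one>\<^bsub>PGL\<^esub>" using assms by (simp add: geodesic_rays_def)
qed

lemma gap_decay: "\<exists>c \<rho>. 0 < c \<and> 0 < \<rho> \<and> \<rho> < 1 \<and> (\<forall>\<gamma>\<in>\<Gamma>. sv_ratio 2 1 \<gamma> \<le> c * \<rho> ^ len \<gamma>)"
proof -
  obtain c \<mu> where c: "c > 0" "\<mu> > 0" "\<And>\<gamma>. \<gamma> \<in> \<Gamma> \<Longrightarrow> sv_ratio 2 1 \<gamma> \<le> c * exp (- \<mu> * real (len \<gamma>))"
    using anosov unfolding projective_anosov_def by blast
  have "exp (- \<mu> * real n) = exp (- \<mu>) ^ n" for n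
    by (simp add: exp_of_nat2_mult[symmetric])
  then show ?thesis using c by (intro exI[of _ c] exI[of _ "exp (- \<mu>)"]) auto
qed

lemma condition_number_bounded:
  "\<exists>K>0. \<forall>\<gamma>\<in>\<Gamma>. len \<gamma> \<le> n \<longrightarrow> condition_number (representative \<gamma>) \<le> K"
proof -
  have "bdd_above ((\<lambda>\<gamma>. condition_number (representative \<gamma>)) ` {\<gamma>\<in>\<Gamma>. len \<gamma> \<le> n})"
    by (intro bdd_above_finite finite_imageI finite_ball)
  then obtain K where "\<forall>\<gamma>\<in>\<Gamma>. len \<gamma> \<le> n \<longrightarrow> condition_number (representative \<gamma>) \<le> K"
    unfolding bdd_above_def by auto
  then show ?thesis by (intro exI[of _ "max K 1"]) fastforce
qed

text \<open>Along a geodesic ray all matrices \<open>a\<^sub>i\<^sup>-\<^sup>1 a\<^sub>j\<close> with \<open>i \<le> j\<close> represent group elements of length \<open>j - i\<close>, so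
  their gaps decay exponentially and the steps have bounded condition number, uniformly in the ray.\<close>

lemma ray_coarse_multiplicativity:
  "\<exists>\<epsilon>>0. \<forall>\<alpha>\<in>geodesic_rays G S. \<forall>i k. 0 < i \<longrightarrow> i \<le> k \<longrightarrow>
     \<epsilon> * (onorm (representative (\<alpha> i)) * onorm (inv_into UNIV (representative (\<alpha> i)) \<circ> representative (\<alpha> k)))
     \<le> onorm (representative (\<alpha> k))"
proof -
  obtain c \<rho> where c: "0 < c" "0 < \<rho>" "\<rho> < 1" "\<And>\<gamma>. \<gamma> \<in> \<Gamma> \<Longrightarrow> sv_ratio 2 1 \<gamma> \<le> c * \<rho> ^ len \<gamma>"
    using gap_decay by blast
  obtain K where K: "\<And>\<gamma>. \<gamma> \<in> \<Gamma> \<Longrightarrow> len \<gamma> \<le> 1 \<Longrightarrow> condition_number (representative \<gamma>) \<le> K"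
    using condition_number_bounded[of 1] by blast
  have c4: "0 < 4 * c" using c by simp
  obtain \<epsilon> where \<epsilon>: "\<epsilon> > 0"
    "\<And>N i j k. dominated_norms K (4 * c) \<rho> N \<Longrightarrow> i \<le> j \<Longrightarrow> j \<le> k \<Longrightarrow> \<epsilon> * (N i j * N j k) \<le> N i k"
    using coarse_multiplicativity[OF c(2,3) c4, of K] by blast
  show ?thesis
  proof (intro exI[of _ \<epsilon>] conjI ballI allI impI \<epsilon>(1))
    fix \<alpha> and i k :: nat assume \<alpha>: "\<alpha> \<in> geodesic_rays G S" and ik: "0 < i" "i \<le> k"
    \<comment> \<open>Starting the sequence at the identity matrix makes \<open>P 0 i\<close> the chosen representative itself.\<close>
    define a where "a i = (if i = 0 then id else representative (\<alpha> i))" for i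
    have PGL: "\<alpha> i \<in> carrier PGL" for i using in_PGL ray_in[OF \<alpha>] by blast
    have a: "a i \<in> \<alpha> i" for i
      using representative_in[OF PGL] id_in_PGL_one by (auto simp: a_def ray_0[OF \<alpha>])
    have lin: "linear (a i)" and bij: "bij (a i)" for i
      using PGL_linear[OF PGL a] PGL_bij[OF PGL a] by auto
    define P where "P i j = inv_into UNIV (a i) \<circ> a j" for i j
    have linP: "linear (P i j)" for i j
      unfolding P_def by (intro linear_compose lin linear_inv_of_bij bij)
    have bijP: "bij (P i j)" for i j
      unfolding P_def by (intro bij_comp bij bij_imp_bij_inv)
    have PP: "P i j \<circ> P j k = P i k" for i j k
      unfolding P_def using bij[of j] by (auto simp: fun_eq_iff bij_is_surj surj_f_inv_f)
    have PI: "P i i = (\<lambda>x. x)" for i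
      unfolding P_def using bij[of i] by (auto simp: fun_eq_iff bij_is_inj)
    define h where "h i j = inv\<^bsub>G\<^esub> (\<alpha> i) \<otimes>\<^bsub>G\<^esub> \<alpha> j" for i j
    have h: "h i j \<in> \<Gamma>" for i j
      unfolding h_def using ray_in[OF \<alpha>] by (intro G.m_closed G.inv_closed)
    have "P i j \<in> inv\<^bsub>PGL\<^esub> (\<alpha> i) \<otimes>\<^bsub>PGL\<^esub> \<alpha> j" for i j
      unfolding P_def by (intro PGL_inv_mult_in PGL a)
    then have Ph: "P i j \<in> h i j" for i j
      unfolding h_def using inv_eq[OF ray_in[OF \<alpha>]] by simp
    have scalar: "\<exists>c. c \<noteq> 0 \<and> P i j = (\<lambda>x. c *\<^sub>R representative (h i j) x)" for i j
      using in_PGL[OF h] Ph by (intro PGL_proportional[of "h i j"] representative_in)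
    define N where "N i j = onorm (P i j)" for i j
    have "dominated_norms K (4 * c) \<rho> N"
      unfolding dominated_norms_def
    proof (intro conjI allI impI)
      show "N i j > 0" for i j unfolding N_def by (intro onorm_bij_pos linP bijP)
      show "N j j = 1" for j unfolding N_def PI by (rule onorm_id)
      show "N i k \<le> N i j * N j k" for i j k
        unfolding N_def PP[of i j k, symmetric] by (intro onorm_compose bounded_linear_of_linear linP)
      show "N j (Suc j) * N (Suc j) j \<le> K" for j
      proof -
        have "inv_into UNIV (P j (Suc j)) = P (Suc j) j"
          using PP[of "Suc j" j "Suc j"] PP[of j "Suc j" j]
          by (intro inv_unique_comp) (auto simp: PI fun_eq_iff)
        then have "N j (Suc j) * N (Suc j) j = condition_number (P j (Suc j))"
          by (simp add: N_def condition_number_def)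
        also have "\<dots> = condition_number (representative (h j (Suc j)))"
        proof -
          have "representative (h j (Suc j)) \<in> h j (Suc j)" using in_PGL[OF h] by (rule representative_in)
          then have "linear (representative (h j (Suc j)))" "bij (representative (h j (Suc j)))"
            using PGL_linear PGL_bij in_PGL[OF h] by blast+
          then show ?thesis using scalar[of j "Suc j"] condition_number_scaleR by metis
        qed
        also have "\<dots> \<le> K" using h ray_step_length[OF \<alpha>, of j "Suc j"] by (intro K) (auto simp: h_def)
        finally show ?thesis .
      qed
      fix i j k l :: nat assume ijkl: "i \<le> j" "j \<le> k" "k \<le> l"
      obtain t where t: "P j k = (\<lambda>x. t *\<^sub>R representative (h j k) x)" using scalar by blast
      have hl: "linear (representative (h j k))" "bij (representative (h j k))"
        using PGL_linear PGL_bij representative_in in_PGL[OF h] by blast+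
      have "N i k * N j l \<le> N i l * N j k + 4 * sv_ratio 2 1 (h j k) * (N i j * (N j k)\<^sup>2 * N k l)"
        using onorm_three_factors_proportional[OF linP[of i j] hl(1) linP[of k l] dim t onorm_bij_pos[OF hl]]
        unfolding PP N_def sv_ratio_def .
      also have "sv_ratio 2 1 (h j k) \<le> c * \<rho> ^ (k - j)"
        using c(4)[OF h[of j k]] ray_step_length[OF \<alpha> ijkl(2)] by (simp add: h_def)
      finally show "N i k * N j l \<le> N i l * N j k + 4 * c * \<rho> ^ (k - j) * (N i j * (N j k)\<^sup>2 * N k l)"
        unfolding N_def by (simp add: mult_left_mono mult_right_mono onorm_pos_le bounded_linear_of_linear linP)
    qed
    then have "\<epsilon> * (N 0 i * N i k) \<le> N 0 k" using ik by (intro \<epsilon>(2)) auto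
    moreover have "P 0 j = a j" for j by (simp add: P_def a_def fun_eq_iff)
    ultimately show "\<epsilon> * (onorm (representative (\<alpha> i)) * onorm (inv_into UNIV (representative (\<alpha> i)) \<circ> representative (\<alpha> k)))
     \<le> onorm (representative (\<alpha> k))"
      using ik by (simp add: N_def a_def P_def)
  qed
qed

lemma dist_major_axis_le:
  assumes "\<gamma> \<in> \<Gamma>" "\<delta> \<in> \<Gamma>" and K: "condition_number (representative (inv\<^bsub>G\<^esub> \<gamma> \<otimes>\<^bsub>G\<^esub> \<delta>)) \<le> K"
    and s: "sv_ratio 2 1 \<gamma> \<le> s"
  shows "dist (major_axis \<gamma>) (major_axis \<delta>) \<le> K * s"
proof -
  define h where "h = inv\<^bsub>G\<^esub> \<gamma> \<otimes>\<^bsub>G\<^esub> \<delta>"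
  have h: "h \<in> \<Gamma>" unfolding h_def using assms by (intro G.m_closed G.inv_closed)
  have "\<gamma> \<otimes>\<^bsub>G\<^esub> h = \<delta>"
    unfolding h_def using assms by (metis G.inv_closed G.l_one G.m_assoc G.r_inv)
  then have "dist (major_axis \<gamma>) (major_axis \<delta>) \<le> condition_number (representative h) * sv_ratio 2 1 \<gamma>"
    using dist_major_axis[OF in_PGL[OF assms(1)] in_PGL[OF h] dim] by simp
  also have "\<dots> \<le> K * s"
  proof (rule mult_mono[OF K[folded h_def] s])
    have rep: "linear (representative \<delta>)" "bij (representative \<delta>)" if "\<delta> \<in> \<Gamma>" for \<delta>
      using PGL_linear PGL_bij representative_in in_PGL[OF that] by blast+
    show "0 \<le> sv_ratio 2 1 \<gamma>"
      unfolding sv_ratio_def using singular_value_1_ge_2(1)[OF rep(1)[OF assms(1)] dim]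
        singular_value_nonneg[OF rep(1)[OF assms(1)], of 1] dim by (intro divide_nonneg_nonneg) auto
    have "0 \<le> condition_number (representative h)"
      unfolding condition_number_def using rep[OF h]
      by (intro mult_nonneg_nonneg onorm_pos_le bounded_linear_of_linear linear_inv_of_bij)
    then show "0 \<le> K" using K[folded h_def] by linarith
  qed
  finally show ?thesis .
qed

lemma ray_converges:
  assumes \<alpha>: "\<alpha> \<in> geodesic_rays G S"
  obtains L where "(\<lambda>i. major_axis (\<alpha> i)) \<longlonglongrightarrow> L"
proof -
  obtain c \<rho> where c: "0 < c" "0 < \<rho>" "\<rho> < 1" "\<And>\<gamma>. \<gamma> \<in> \<Gamma> \<Longrightarrow> sv_ratio 2 1 \<gamma> \<le> c * \<rho> ^ len \<gamma>"
    using gap_decay by blast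
  obtain K where K: "K > 0" "\<And>\<gamma>. \<gamma> \<in> \<Gamma> \<Longrightarrow> len \<gamma> \<le> 1 \<Longrightarrow> condition_number (representative \<gamma>) \<le> K"
    using condition_number_bounded[of 1] by blast
  define X where "X i = major_axis (\<alpha> i)" for i
  define M where "M = K * c / (1 - \<rho>)"
  have M: "M > 0" "K * c + M * \<rho> = M" using K c by (auto simp: M_def field_simps)
  have step: "dist (X i) (X (Suc i)) \<le> K * (c * \<rho> ^ i)" for i
    unfolding X_def
  proof (rule dist_major_axis_le)
    show "condition_number (representative (inv\<^bsub>G\<^esub> \<alpha> i \<otimes>\<^bsub>G\<^esub> \<alpha> (Suc i))) \<le> K"
      using ray_in[OF \<alpha>] ray_step_length[OF \<alpha>, of i "Suc i"] by (intro K G.m_closed G.inv_closed) auto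
    show "sv_ratio 2 1 (\<alpha> i) \<le> c * \<rho> ^ i" using c(4)[OF ray_in[OF \<alpha>], of i] ray_length[OF \<alpha>] by simp
  qed (use ray_in[OF \<alpha>] in auto)
  have tail: "dist (X i) (X (i + t)) \<le> M * \<rho> ^ i" for i t
  proof (induction t arbitrary: i)
    case (Suc t)
    have "dist (X i) (X (i + Suc t)) \<le> dist (X i) (X (Suc i)) + dist (X (Suc i)) (X (Suc i + t))"
      using dist_triangle[of "X i" "X (i + Suc t)" "X (Suc i)"] by simp
    also have "\<dots> \<le> K * (c * \<rho> ^ i) + M * \<rho> ^ Suc i" by (intro add_mono step Suc.IH)
    also have "\<dots> = (K * c + M * \<rho>) * \<rho> ^ i" by (simp add: algebra_simps)
    finally show ?case unfolding M(2) .
  qed (use M c in simp)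
  have "Cauchy X"
  proof (rule metric_CauchyI)
    fix e :: real assume "e > 0"
    have "(\<lambda>n. M * \<rho> ^ n) \<longlonglongrightarrow> M * 0"
      using c by (intro tendsto_intros LIMSEQ_realpow_zero) auto
    then have "\<forall>\<^sub>F n in sequentially. M * \<rho> ^ n < e / 2"
      using \<open>e > 0\<close> by (intro order_tendstoD(2)) auto
    then obtain n where n: "M * \<rho> ^ n < e / 2"
      by (auto simp: eventually_sequentially)
    have near: "dist (X n) (X i) < e / 2" if "n \<le> i" for i
      using tail[of n "i - n"] n that by simp
    show "\<exists>n. \<forall>i\<ge>n. \<forall>j\<ge>n. dist (X i) (X j) < e"
    proof (intro exI[of _ n] allI impI)
      fix i j assume "n \<le> i" "n \<le> j"
      then show "dist (X i) (X j) < e"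
        using near[of i] near[of j] dist_triangle3[of "X i" "X j" "X n"] by linarith
    qed
  qed
  then obtain L where "X \<longlonglongrightarrow> L" using Cauchy_proj_convergent by blast
  then show ?thesis using that unfolding X_def by blast
qed

text \<open>The definite description in \<^const>\<open>boundary_map\<close> is legitimate: asymptotic rays differ at time \<open>i\<close>
  by right multiplication with an element of bounded length, which moves the axis by \<open>O(\<rho> ^ i)\<close>,
  so all rays of the class have the same limit.\<close>

lemma boundary_map_limit:
  assumes x: "x \<in> group_boundary G S"
  obtains \<alpha> where "\<alpha> \<in> geodesic_rays G S" "(\<lambda>i. major_axis (\<alpha> i)) \<longlonglongrightarrow> boundary_map x"
proof -
  obtain c \<rho> where c: "0 < c" "0 < \<rho>" "\<rho> < 1" "\<And>\<gamma>. \<gamma> \<in> \<Gamma> \<Longrightarrow> sv_ratio 2 1 \<gamma> \<le> c * \<rho> ^ len \<gamma>"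
    using gap_decay by blast
  obtain \<alpha> where \<alpha>: "\<alpha> \<in> geodesic_rays G S" "x = asymptotic_rays G S `` {\<alpha>}"
    using x unfolding group_boundary_def by (rule quotientE)
  obtain L where L: "(\<lambda>i. major_axis (\<alpha> i)) \<longlonglongrightarrow> L" using ray_converges[OF \<alpha>(1)] .
  have "word_dist G S (\<alpha> i) (\<alpha> i) \<le> 0" for i
    using ray_step_length[OF \<alpha>(1), of i i] by (simp add: word_dist_def)
  then have \<alpha>x: "\<alpha> \<in> x" unfolding \<alpha>(2) asymptotic_rays_def using \<alpha>(1) by blast
  have "boundary_map x = L"
    unfolding boundary_map_def
  proof (rule the_equality)
    show "\<forall>\<beta>\<in>x. (\<lambda>i. major_axis (\<beta> i)) \<longlonglongrightarrow> L"
    proof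
      fix \<beta> assume "\<beta> \<in> x"
      then obtain n where \<beta>: "\<beta> \<in> geodesic_rays G S" "\<And>i. word_dist G S (\<alpha> i) (\<beta> i) \<le> n"
        unfolding \<alpha>(2) asymptotic_rays_def by auto
      obtain K where K: "K > 0" "\<And>\<gamma>. \<gamma> \<in> \<Gamma> \<Longrightarrow> len \<gamma> \<le> n \<Longrightarrow> condition_number (representative \<gamma>) \<le> K"
        using condition_number_bounded[of n] by blast
      have bound: "dist (major_axis (\<alpha> i)) (major_axis (\<beta> i)) \<le> K * (c * \<rho> ^ i)" for i
      proof (rule dist_major_axis_le)
        show "condition_number (representative (inv\<^bsub>G\<^esub> \<alpha> i \<otimes>\<^bsub>G\<^esub> \<beta> i)) \<le> K"
          using ray_in[OF \<alpha>(1)] ray_in[OF \<beta>(1)] \<beta>(2)[of i] unfolding word_dist_def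
          by (intro K G.m_closed G.inv_closed) auto
        show "sv_ratio 2 1 (\<alpha> i) \<le> c * \<rho> ^ i"
          using c(4)[OF ray_in[OF \<alpha>(1)], of i] ray_length[OF \<alpha>(1)] by simp
      qed (use ray_in[OF \<alpha>(1)] ray_in[OF \<beta>(1)] in auto)
      have "(\<lambda>i. K * (c * \<rho> ^ i)) \<longlonglongrightarrow> K * (c * 0)"
        using c by (intro tendsto_intros LIMSEQ_realpow_zero) auto
      moreover have "(\<lambda>i. dist (major_axis (\<alpha> i)) L) \<longlonglongrightarrow> 0"
        using L by (rule tendsto_dist_iff[THEN iffD1])
      ultimately have lim: "(\<lambda>i. K * (c * \<rho> ^ i) + dist (major_axis (\<alpha> i)) L) \<longlonglongrightarrow> 0"
        by (auto intro: tendsto_add_zero)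
      have "norm (dist (major_axis (\<beta> i)) L) \<le> K * (c * \<rho> ^ i) + dist (major_axis (\<alpha> i)) L" for i
        using bound[of i] dist_triangle3[of "major_axis (\<beta> i)" L "major_axis (\<alpha> i)"] by simp
      then have "(\<lambda>i. dist (major_axis (\<beta> i)) L) \<longlonglongrightarrow> 0"
        using lim by (intro Lim_null_comparison[of "\<lambda>i. dist (major_axis (\<beta> i)) L"] always_eventually allI)
      then show "(\<lambda>i. major_axis (\<beta> i)) \<longlonglongrightarrow> L" by (rule tendsto_dist_iff[THEN iffD2])
    qed
    show "L' = L" if "\<forall>\<beta>\<in>x. (\<lambda>i. major_axis (\<beta> i)) \<longlonglongrightarrow> L'" for L'
      using that \<alpha>x L LIMSEQ_unique by blast
  qed
  then show ?thesis using that[OF \<alpha>(1)] L by simp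
qed

text \<open>Let \<open>w\<^sub>k\<close> be a unit vector on the axis of \<open>\<alpha>\<^sub>k\<close> and \<open>v\<^sub>k\<close> the unit vector with \<open>\<alpha>\<^sub>k v\<^sub>k = onorm \<alpha>\<^sub>k w\<^sub>k\<close>. Then
  \<open>\<alpha>\<^sub>n\<^sup>-\<^sup>1 w\<^sub>k = \<alpha>\<^sub>n\<^sup>-\<^sup>1 \<alpha>\<^sub>k v\<^sub>k / onorm \<alpha>\<^sub>k\<close> has norm at most \<open>onorm (\<alpha>\<^sub>n\<^sup>-\<^sup>1 \<alpha>\<^sub>k) / onorm \<alpha>\<^sub>k\<close>, which by
  coarse multiplicativity is at most \<open>1 / (\<epsilon> onorm \<alpha>\<^sub>n)\<close> for all \<open>k \<ge> n\<close>. This bound passes to the limit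
  \<open>k \<rightarrow> \<infinity>\<close>: the limit point lies in the shadow of \<open>\<alpha>\<^sub>n\<close>, the image under \<open>\<alpha>\<^sub>n\<close> of the
  directions which \<open>\<alpha>\<^sub>n\<close> stretches by a definite proportion of its norm.\<close>

lemma limit_set_in_shadows:
  "\<exists>\<epsilon>>0. \<forall>L\<in>limit_set \<Gamma> S. \<exists>z. norm z = 1 \<and> L = proj_line z \<and>
     (\<forall>n>0. \<exists>\<gamma>\<in>\<Gamma>. len \<gamma> = n \<and>
        \<epsilon> * onorm (representative \<gamma>) * norm (inv_into UNIV (representative \<gamma>) z) \<le> 1)"
proof -
  obtain \<epsilon> where \<epsilon>: "\<epsilon> > 0" "\<And>\<alpha> i k. \<alpha> \<in> geodesic_rays G S \<Longrightarrow> 0 < i \<Longrightarrow> i \<le> k \<Longrightarrow>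
     \<epsilon> * (onorm (representative (\<alpha> i)) * onorm (inv_into UNIV (representative (\<alpha> i)) \<circ> representative (\<alpha> k)))
     \<le> onorm (representative (\<alpha> k))"
    using ray_coarse_multiplicativity by blast
  show ?thesis
  proof (intro exI[of _ \<epsilon>] conjI ballI \<epsilon>(1))
    fix L assume "L \<in> limit_set \<Gamma> S"
    then obtain x where x: "x \<in> group_boundary G S" "L = boundary_map x"
      unfolding limit_set_def by (rule imageE)
    obtain \<alpha> where \<alpha>: "\<alpha> \<in> geodesic_rays G S" and lim: "(\<lambda>i. major_axis (\<alpha> i)) \<longlonglongrightarrow> L"
      using boundary_map_limit[OF x(1)] unfolding x(2) .
    define A where "A i = representative (\<alpha> i)" for i
    have A: "linear (A i)" "bij (A i)" for i
      using PGL_linear PGL_bij representative_in in_PGL[OF ray_in[OF \<alpha>]] unfolding A_def by blast+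
    have Apos: "onorm (A i) > 0" for i by (rule onorm_bij_pos[OF A])
    have "\<exists>v. norm v = 1 \<and> norm (A i v) = onorm (A i) \<and> major_axis (\<alpha> i) = proj_line (A i v)" for i
      using major_axis_eq[OF in_PGL[OF ray_in[OF \<alpha>, of i]]] unfolding A_def by metis
    then obtain v where v: "\<And>i. norm (v i) = 1" "\<And>i. norm (A i (v i)) = onorm (A i)"
      "\<And>i. major_axis (\<alpha> i) = proj_line (A i (v i))"
      by metis
    define w where "w i = (1 / onorm (A i)) *\<^sub>R A i (v i)" for i
    have w: "norm (w i) = 1" "major_axis (\<alpha> i) = proj_line (w i)" for i
      using v[of i] Apos[of i] proj_line_scaleR[of "1 / onorm (A i)" "A i (v i)"] by (auto simp: w_def)
    define z where "z = (1 / norm (proj_vec L)) *\<^sub>R proj_vec L"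
    have z: "norm z = 1" "L = proj_line z"
      using proj_vec[of L] proj_line_scaleR[of "1 / norm (proj_vec L)" "proj_vec L"] by (auto simp: z_def)
    have nz: "z \<noteq> 0" "w i \<noteq> 0" for i using z(1) w(1)[of i] by auto
    \<comment> \<open>The vectors \<open>w i\<close> converge to the line through \<open>z\<close>, but their signs may oscillate; so they
      are compared with their projections to this line.\<close>
    define D where "D i = norm (w i - (z \<bullet> w i) *\<^sub>R z)" for i
    have D: "D i = dist (major_axis (\<alpha> i)) L" for i
      unfolding D_def w z using dist_proj_line[OF nz] sin_vec_angle_le(2)[OF z(1) w(1), of i]
      by (simp add: dist_commute)
    have D0: "D \<longlonglongrightarrow> 0"
      unfolding D using lim by (rule tendsto_dist_iff[THEN iffD1])
    have "\<bar>z \<bullet> w i\<bar> = sqrt (1 - (D i)\<^sup>2)" for i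
    proof -
      have "z \<bullet> z = 1" "w i \<bullet> w i = 1" using z(1) w(1)[of i] by (simp_all add: dot_square_norm)
      then have "(D i)\<^sup>2 = 1 - (z \<bullet> w i)\<^sup>2"
        unfolding D_def power2_norm_eq_inner
        by (simp add: inner_diff_left inner_diff_right inner_commute power2_eq_square)
      then show ?thesis by simp
    qed
    moreover have "(\<lambda>i. sqrt (1 - (D i)\<^sup>2)) \<longlonglongrightarrow> sqrt (1 - 0\<^sup>2)"
      by (intro tendsto_intros D0)
    ultimately have one: "(\<lambda>i. \<bar>z \<bullet> w i\<bar>) \<longlonglongrightarrow> 1" by simp
    have "\<epsilon> * onorm (A n) * norm (inv_into UNIV (A n) z) \<le> 1" if n: "n > 0" for n
    proof -
      define B where "B = inv_into UNIV (A n)"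
      have linB: "linear B" unfolding B_def by (rule linear_inv_of_bij[OF A])
      have Bw: "\<epsilon> * onorm (A n) * norm (B (w k)) \<le> 1" if "n \<le> k" for k
      proof -
        have "norm (B (A k (v k))) \<le> onorm (B \<circ> A k)"
          using onorm[OF bounded_linear_of_linear[OF linear_compose[OF A(1) linB]], of k "v k"] v(1)[of k] by simp
        then have "\<epsilon> * onorm (A n) * norm (B (A k (v k))) \<le> \<epsilon> * onorm (A n) * onorm (B \<circ> A k)"
          using \<epsilon>(1) Apos[of n] by (intro mult_left_mono) auto
        also have "\<dots> \<le> onorm (A k)"
          using \<epsilon>(2)[OF \<alpha> n that] unfolding A_def B_def by (simp add: mult.assoc)
        finally show ?thesis
          using Apos[of k] by (simp add: w_def linear_scale[OF linB] field_simps)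
      qed
      have "\<epsilon> * onorm (A n) * (\<bar>z \<bullet> w k\<bar> * norm (B z)) \<le> 1 + \<epsilon> * onorm (A n) * (onorm B * D k)"
        if "n \<le> k" for k
      proof -
        have "\<bar>z \<bullet> w k\<bar> * norm (B z) = norm (B (w k) - B (w k - (z \<bullet> w k) *\<^sub>R z))"
          by (simp add: linear_diff[OF linB] linear_scale[OF linB])
        also have "\<dots> \<le> norm (B (w k)) + norm (B (w k - (z \<bullet> w k) *\<^sub>R z))" by (rule norm_triangle_ineq4)
        also have "\<dots> \<le> norm (B (w k)) + onorm B * D k"
          unfolding D_def using onorm[OF bounded_linear_of_linear[OF linB]] by simp
        finally have "\<epsilon> * onorm (A n) * (\<bar>z \<bullet> w k\<bar> * norm (B z))
            \<le> \<epsilon> * onorm (A n) * (norm (B (w k)) + onorm B * D k)"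
          using \<epsilon>(1) Apos[of n] by (intro mult_left_mono) auto
        then show ?thesis using Bw[OF that] by (simp add: distrib_left)
      qed
      then have "\<forall>\<^sub>F k in sequentially. \<epsilon> * onorm (A n) * (\<bar>z \<bullet> w k\<bar> * norm (B z))
          \<le> 1 + \<epsilon> * onorm (A n) * (onorm B * D k)"
        unfolding eventually_sequentially by blast
      moreover have "(\<lambda>k. \<epsilon> * onorm (A n) * (\<bar>z \<bullet> w k\<bar> * norm (B z))) \<longlonglongrightarrow> \<epsilon> * onorm (A n) * (1 * norm (B z))"
        by (intro tendsto_mult one tendsto_const)
      moreover have "(\<lambda>k. 1 + \<epsilon> * onorm (A n) * (onorm B * D k)) \<longlonglongrightarrow> 1 + \<epsilon> * onorm (A n) * (onorm B * 0)"
        by (intro tendsto_mult tendsto_add D0 tendsto_const)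
      ultimately show ?thesis
        using tendsto_le[OF sequentially_bot] unfolding B_def by fastforce
    qed
    then show "\<exists>z. norm z = 1 \<and> L = proj_line z \<and> (\<forall>n>0. \<exists>\<gamma>\<in>\<Gamma>. len \<gamma> = n \<and>
        \<epsilon> * onorm (representative \<gamma>) * norm (inv_into UNIV (representative \<gamma>) z) \<le> 1)"
      using z ray_in[OF \<alpha>] ray_length[OF \<alpha>] unfolding A_def by blast
  qed
qed

end

section \<open>Comparison of the dimension with the affinity exponent\<close>

context projective_anosov_group
begin

text \<open>For every large \<open>n\<close> the limit set is covered by the ellipsoids of the finitely many \<open>\<gamma>\<close> of length
  \<open>n\<close>. Covering each of them by cubes of side \<open>x = \<sigma>\<^sub>p\<^sub>+\<^sub>1 / \<sigma>\<^sub>1\<close> costs, up to a constant,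
  \<open>(\<Prod>i=2..p. \<sigma>\<^sub>i / \<sigma>\<^sub>1) x powr (t - (p - 1))\<close>, which is at most the term of \<open>\<gamma>\<close> in the affinity series
  at \<open>s\<close> because \<open>x \<le> 1\<close>. Since the series converges, the part of it over \<open>\<gamma>\<close> of length \<open>n\<close>
  tends to \<open>0\<close>. Taking \<open>t\<close> rather than \<open>s\<close> as the dimension includes the case \<open>s = 0\<close>, where
  every positive \<open>t\<close> is needed.\<close>

lemma hausdorff_measure_limit_set_zero:
  assumes p: "p \<in> {1..DIM('a) - 1}" and s: "real p - 1 \<le> s" and fin: "affinity_series \<Gamma> p s < \<infinity>"
    and t: "s \<le> t" "0 < t"
  shows "hausdorff_measure t (limit_set \<Gamma> S) = 0"
proof (rule hausdorff_measure_zeroI)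
  fix e \<delta> :: real assume e: "e > 0" and \<delta>: "\<delta> > 0"
  let ?d = "DIM('a)"
  have pd: "p + 1 \<in> {2..?d}" using p dim by auto
  define r where "r \<gamma> i = sv_ratio i 1 \<gamma>" for \<gamma> :: "('a \<Rightarrow> 'a) set" and i
  define \<phi> where "\<phi> \<gamma> = (\<Prod>i=2..p. r \<gamma> i) * r \<gamma> (p + 1) powr (s - (real p - 1))" for \<gamma>
  have rep: "linear (representative \<gamma>)" "bij (representative \<gamma>)" if "\<gamma> \<in> \<Gamma>" for \<gamma>
    using PGL_linear PGL_bij representative_in in_PGL[OF that] by blast+
  have rnn: "0 \<le> r \<gamma> i" if "\<gamma> \<in> \<Gamma>" "i \<in> {1..?d}" for \<gamma> i
    unfolding r_def sv_ratio_def using that dim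
    by (intro divide_nonneg_nonneg singular_value_nonneg rep) auto
  have r1: "r \<gamma> i \<le> r \<gamma> 2" "r \<gamma> 2 \<le> 1" if "\<gamma> \<in> \<Gamma>" "i \<in> {2..?d}" for \<gamma> i
  proof -
    have pos: "0 < singular_value 1 (representative \<gamma>)"
      unfolding singular_value_1[OF rep(1)[OF that(1)]] by (rule onorm_bij_pos[OF rep[OF that(1)]])
    show "r \<gamma> i \<le> r \<gamma> 2" unfolding r_def sv_ratio_def using that pos
      by (intro divide_right_mono singular_value_antimono rep) auto
    show "r \<gamma> 2 \<le> 1" unfolding r_def sv_ratio_def using that pos dim
        singular_value_antimono[OF rep(1)[OF that(1)], of 1 2] by simp
  qed
  obtain c \<rho> where c: "0 < c" "0 < \<rho>" "\<rho> < 1" "\<And>\<gamma>. \<gamma> \<in> \<Gamma> \<Longrightarrow> r \<gamma> 2 \<le> c * \<rho> ^ len \<gamma>"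
    using gap_decay unfolding r_def by blast
  obtain \<epsilon> where \<epsilon>: "\<epsilon> > 0" and shadow: "\<And>L. L \<in> limit_set \<Gamma> S \<Longrightarrow> \<exists>z. norm z = 1 \<and> L = proj_line z \<and>
     (\<forall>n>0. \<exists>\<gamma>\<in>\<Gamma>. len \<gamma> = n \<and>
        \<epsilon> * onorm (representative \<gamma>) * norm (inv_into UNIV (representative \<gamma>) z) \<le> 1)"
    using limit_set_in_shadows by blast
  define C where "C = (4 / \<epsilon> + 1) ^ (?d - 1) * real ?d powr t"
  have C: "C > 0" unfolding C_def using \<epsilon>
    by (intro mult_pos_pos zero_less_power add_pos_pos divide_pos_pos) auto
  have \<phi>nn: "0 \<le> \<phi> \<gamma>" if "\<gamma> \<in> \<Gamma>" for \<gamma>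
    unfolding \<phi>_def using that p by (intro mult_nonneg_nonneg prod_nonneg rnn) auto
  have eC: "e / C > 0" using e C by simp
  obtain T where T: "finite T" "T \<subseteq> \<Gamma>" "\<And>U. finite U \<Longrightarrow> U \<subseteq> \<Gamma> - T \<Longrightarrow> sum \<phi> U \<le> e / C"
    using finite_infsum_tail[of \<Gamma> \<phi>, OF \<phi>nn _ eC] fin unfolding affinity_series_def \<phi>_def r_def by blast
  have "(\<lambda>n. c * \<rho> ^ n) \<longlonglongrightarrow> c * 0"
    using c by (intro tendsto_intros LIMSEQ_realpow_zero) auto
  moreover have "min (\<delta> / real ?d) (\<epsilon> * sqrt (3 / 4 / real ?d)) > 0" using \<delta> \<epsilon> by simp
  ultimately have "\<forall>\<^sub>F n in sequentially. c * \<rho> ^ n < min (\<delta> / real ?d) (\<epsilon> * sqrt (3 / 4 / real ?d))"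
    by (intro order_tendstoD(2)) auto
  then obtain n0 where n0: "\<And>n. n \<ge> n0 \<Longrightarrow> c * \<rho> ^ n < min (\<delta> / real ?d) (\<epsilon> * sqrt (3 / 4 / real ?d))"
    by (auto simp: eventually_sequentially)
  \<comment> \<open>Beyond \<open>n0\<close> the cubes have diameter at most \<open>\<delta>\<close> and the gaps are good enough for the affine
    charts; beyond all lengths occurring in \<open>T\<close>, the elements of length \<open>n\<close> belong to the tail.\<close>
  define n where "n = Suc (n0 + Max (insert 0 (len ` T)))"
  have nT: "len \<gamma> < n" if "\<gamma> \<in> T" for \<gamma>
  proof -
    have "len \<gamma> \<le> Max (insert 0 (len ` T))" using that T(1) by (intro Max_ge) auto
    then show ?thesis by (simp add: n_def)
  qed
  define I where "I = {\<gamma>\<in>\<Gamma>. len \<gamma> = n}"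
  have finI: "finite I" unfolding I_def by (rule finite_subset[OF _ finite_ball[of n]]) auto
  have r2: "real ?d * r \<gamma> 2 \<le> \<delta>" "real ?d * (r \<gamma> 2)\<^sup>2 \<le> 3 / 4 * \<epsilon>\<^sup>2" if "\<gamma> \<in> I" for \<gamma>
  proof -
    have \<gamma>: "\<gamma> \<in> \<Gamma>" "len \<gamma> = n" using that by (auto simp: I_def)
    have lt: "r \<gamma> 2 < \<delta> / real ?d" "r \<gamma> 2 < \<epsilon> * sqrt (3 / 4 / real ?d)"
      using c(4)[OF \<gamma>(1)] n0[of n] \<gamma>(2) by (auto simp: n_def)
    show "real ?d * r \<gamma> 2 \<le> \<delta>" using lt(1) by (simp add: field_simps)
    have "(r \<gamma> 2)\<^sup>2 \<le> (\<epsilon> * sqrt (3 / 4 / real ?d))\<^sup>2"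
      using lt(2) rnn[OF \<gamma>(1), of 2] dim by (intro power_mono) auto
    then show "real ?d * (r \<gamma> 2)\<^sup>2 \<le> 3 / 4 * \<epsilon>\<^sup>2"
      by (simp add: power_mult_distrib field_simps)
  qed
  have ex: "\<forall>\<gamma>\<in>I. \<exists>F. finite F \<and>
     (\<forall>z. norm z = 1 \<longrightarrow> \<epsilon> * onorm (representative \<gamma>) * norm (inv_into UNIV (representative \<gamma>) z) \<le> 1 \<longrightarrow> proj_line z \<in> \<Union>F) \<and>
     (\<forall>U\<in>F. bounded U \<and> diameter U \<le> real ?d * r \<gamma> (p + 1)) \<and>
     real (card F) \<le> (4 / \<epsilon> + 1) ^ (?d - 1) * (\<Prod>i=2..p. r \<gamma> i / r \<gamma> (p + 1))"
    (is "\<forall>\<gamma>\<in>I. ?Q \<gamma>")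
  proof
    fix \<gamma> assume \<gamma>: "\<gamma> \<in> I"
    then have "\<gamma> \<in> \<Gamma>" by (simp add: I_def)
    from ellipsoid_cover(2)[OF rep[OF this] dim p \<epsilon> r2(2)[OF \<gamma>, unfolded r_def sv_ratio_def]]
    show "?Q \<gamma>" unfolding r_def sv_ratio_def .
  qed
  obtain F where F': "\<forall>\<gamma>\<in>I. finite (F \<gamma>) \<and>
     (\<forall>z. norm z = 1 \<longrightarrow> \<epsilon> * onorm (representative \<gamma>) * norm (inv_into UNIV (representative \<gamma>) z) \<le> 1 \<longrightarrow> proj_line z \<in> \<Union>(F \<gamma>)) \<and>
     (\<forall>U\<in>F \<gamma>. bounded U \<and> diameter U \<le> real ?d * r \<gamma> (p + 1)) \<and>
     real (card (F \<gamma>)) \<le> (4 / \<epsilon> + 1) ^ (?d - 1) * (\<Prod>i=2..p. r \<gamma> i / r \<gamma> (p + 1))"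
    using bchoice[OF ex] by (rule exE)
  have F: "finite (F \<gamma>)"
    "norm z = 1 \<Longrightarrow> \<epsilon> * onorm (representative \<gamma>) * norm (inv_into UNIV (representative \<gamma>) z) \<le> 1 \<Longrightarrow> proj_line z \<in> \<Union>(F \<gamma>)"
    "U \<in> F \<gamma> \<Longrightarrow> bounded U \<and> diameter U \<le> real ?d * r \<gamma> (p + 1)"
    "real (card (F \<gamma>)) \<le> (4 / \<epsilon> + 1) ^ (?d - 1) * (\<Prod>i=2..p. r \<gamma> i / r \<gamma> (p + 1))"
    if "\<gamma> \<in> I" for \<gamma> z U
    using bspec[OF F' that] by blast+
  have cost: "(\<Sum>U\<in>F \<gamma>. diameter U powr t) \<le> C * \<phi> \<gamma>" if \<gamma>I: "\<gamma> \<in> I" for \<gamma>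
  proof -
    have \<gamma>: "\<gamma> \<in> \<Gamma>" using \<gamma>I by (simp add: I_def)
    define x where "x = r \<gamma> (p + 1)"
    have x: "0 < x"
      using ellipsoid_cover(1)[OF rep[OF \<gamma>] dim p \<epsilon> r2(2)[OF \<gamma>I, unfolded r_def sv_ratio_def]]
      unfolding x_def r_def sv_ratio_def .
    have "x \<le> 1" unfolding x_def using r1[OF \<gamma> pd] by linarith
    have "(\<Sum>U\<in>F \<gamma>. diameter U powr t) \<le> (\<Sum>U\<in>F \<gamma>. (real ?d * x) powr t)"
      using F(3)[OF \<gamma>I] t unfolding x_def by (intro sum_mono powr_mono2 diameter_ge_0) auto
    also have "\<dots> = real (card (F \<gamma>)) * (real ?d powr t * x powr t)" using x by (simp add: powr_mult)
    also have "\<dots> \<le> (4 / \<epsilon> + 1) ^ (?d - 1) * (\<Prod>i=2..p. r \<gamma> i / x) * (real ?d powr t * x powr t)"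
      using F(4)[OF \<gamma>I] unfolding x_def by (intro mult_right_mono) auto
    also have "\<dots> = C * ((\<Prod>i=2..p. r \<gamma> i) * (x powr t / x ^ (p - 1)))"
      by (simp add: C_def prod_dividef numeral_2_eq_2 field_simps)
    also have "x powr t / x ^ (p - 1) = x powr (t - (real p - 1))"
      using x p by (simp add: powr_diff powr_realpow[symmetric] of_nat_diff)
    also have "C * ((\<Prod>i=2..p. r \<gamma> i) * x powr (t - (real p - 1)))
        \<le> C * ((\<Prod>i=2..p. r \<gamma> i) * x powr (s - (real p - 1)))"
      using C x \<open>x \<le> 1\<close> t p rnn[OF \<gamma>]
      by (intro mult_left_mono powr_mono' prod_nonneg) auto
    finally show ?thesis by (simp add: \<phi>_def x_def)
  qed
  show "\<exists>F. finite F \<and> limit_set \<Gamma> S \<subseteq> \<Union>F \<and>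
     (\<forall>U\<in>F. bounded U \<and> diameter U \<le> \<delta>) \<and> (\<Sum>U\<in>F. diameter U powr t) \<le> e"
  proof (intro exI[of _ "\<Union>\<gamma>\<in>I. F \<gamma>"] conjI ballI)
    show "finite (\<Union>\<gamma>\<in>I. F \<gamma>)" using finI F(1) by blast
    show "limit_set \<Gamma> S \<subseteq> \<Union>(\<Union>\<gamma>\<in>I. F \<gamma>)"
    proof
      fix L assume "L \<in> limit_set \<Gamma> S"
      then obtain z where z: "norm z = 1" "L = proj_line z" "\<forall>n>0. \<exists>\<gamma>\<in>\<Gamma>. len \<gamma> = n \<and>
        \<epsilon> * onorm (representative \<gamma>) * norm (inv_into UNIV (representative \<gamma>) z) \<le> 1"
        using shadow by blast
      have "n > 0" by (simp add: n_def)
      then obtain \<gamma> where \<gamma>: "\<gamma> \<in> I" "\<epsilon> * onorm (representative \<gamma>) * norm (inv_into UNIV (representative \<gamma>) z) \<le> 1"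
        using z(3) unfolding I_def by blast
      have "proj_line z \<in> \<Union>(F \<gamma>)" by (rule F(2)[OF \<gamma>(1) z(1) \<gamma>(2)])
      then show "L \<in> \<Union>(\<Union>\<gamma>\<in>I. F \<gamma>)" using \<gamma>(1) z(2) by blast
    qed
    fix U assume "U \<in> (\<Union>\<gamma>\<in>I. F \<gamma>)"
    then obtain \<gamma> where \<gamma>: "\<gamma> \<in> I" "U \<in> F \<gamma>" by blast
    show "bounded U" using F(3)[OF \<gamma>] by blast
    have "real ?d * r \<gamma> (p + 1) \<le> real ?d * r \<gamma> 2"
      using \<gamma>(1) pd by (intro mult_left_mono r1(1)) (auto simp: I_def)
    then show "diameter U \<le> \<delta>" using F(3)[OF \<gamma>] r2(1)[OF \<gamma>(1)] by linarith
  next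
    have "(\<Sum>U\<in>(\<Union>\<gamma>\<in>I. F \<gamma>). diameter U powr t) \<le> (\<Sum>\<gamma>\<in>I. \<Sum>U\<in>F \<gamma>. diameter U powr t)"
      by (rule sum_Union_le_sum[OF finI F(1)]) auto
    also have "\<dots> \<le> (\<Sum>\<gamma>\<in>I. C * \<phi> \<gamma>)" by (intro sum_mono cost)
    also have "\<dots> = C * sum \<phi> I" by (simp add: sum_distrib_left)
    also have "\<dots> \<le> C * (e / C)"
      using C nT by (intro mult_left_mono T(3) finI) (auto simp: I_def)
    finally show "(\<Sum>U\<in>(\<Union>\<gamma>\<in>I. F \<gamma>). diameter U powr t) \<le> e" using C by simp
  qed
qed

end

theorem theorem2:
  fixes \<Gamma> S :: "('a::euclidean_space \<Rightarrow> 'a) set set"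
  assumes "DIM('a) \<ge> 2"
    and "projective_anosov \<Gamma> S"
  shows "hausdorff_dim (limit_set \<Gamma> S) \<le> affinity_exponent \<Gamma>"
proof -
  interpret projective_anosov_group \<Gamma> S using assms by unfold_locales
  show ?thesis
    unfolding affinity_exponent_def
  proof (rule Inf_greatest, clarify)
    fix s p assume p: "p \<in> {1..DIM('a) - 1}" and s: "real p - 1 \<le> s" and fin: "affinity_series \<Gamma> p s < \<infinity>"
    show "hausdorff_dim (limit_set \<Gamma> S) \<le> ereal s"
    proof (rule ereal_le_epsilon2)
      fix e :: real assume "e > 0"
      then have "0 < s + e" using s p by auto
      moreover have "hausdorff_measure (s + e) (limit_set \<Gamma> S) = 0"
        using \<open>e > 0\<close> \<open>0 < s + e\<close> by (intro hausdorff_measure_limit_set_zero[OF p s fin]) auto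
      ultimately show "hausdorff_dim (limit_set \<Gamma> S) \<le> ereal s + ereal e"
        unfolding hausdorff_dim_def by (auto intro!: Inf_lower)
    qed
  qed
qed

end
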